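(* Let $c:X\times X\to[0,\infty)$ be a proper transportation cost, $\nu\in\mathcal P(\mathcal P(X))$ and $\hat P\in\mathcal P_c(X)$. Then $$\sup_{M\in\mathbb N}\frac1M\,W_{c^M}\Big(\int_{\mathcal P(X)}P^{\otimes M}\,d\nu(P),\ \hat P^{\otimes M}\Big)=\int_{\mathcal P(X)}W_c(P,\hat P)\,d\nu(P)$$ (both sides possibly $+\infty$).
   Context: $X$ nonempty Polish; $\mathcal P(X)$ is the space of Borel probability measures with the weak topology (itself Polish), and $\mathcal P(\mathcal P(X))$ the Borel probability measures on it. A transportation cost is lower semi-continuous, symmetric, $c(x,x)=0$; it is proper if $c(x,y)\le K(c(x,z)+c(z,y))$ for some $K>0$ and all sets $\{x:c(x_0,x)\le r\}$ are compact. $\mathcal P_c(X)=\{P:\int c(x_0,\cdot)dP<\infty\}$. $W_c(P_1,P_2)=\inf_{\Lambda\in\Gamma(P_1,P_2)}\int c\,d\Lambda$; $c^M(x,y)=\sum_{i\le M}c(x_i,y_i)$. The mixture $\int P^{\otimes M}d\nu(P)$ is the Borel probability measure on $X^M$ given by $A\mapsto\int P^{\otimes M}(A)\,d\nu(P)$. *)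

theory Defs
  imports "HOL-Probability.Probability"
begin

definition lsc_cost :: "('a::topological_space \<Rightarrow> 'a \<Rightarrow> real) \<Rightarrow> bool" where
  "lsc_cost c \<longleftrightarrow> (\<forall>t. closed {z::'a \<times> 'a. c (fst z) (snd z) \<le> t})"

definition transport_cost :: "('a::topological_space \<Rightarrow> 'a \<Rightarrow> real) \<Rightarrow> bool" where
  "transport_cost c \<longleftrightarrow> lsc_cost c \<and> (\<forall>x y. c x y = c y x) \<and> (\<forall>x. c x x = 0)"

definition proper_cost :: "('a::topological_space \<Rightarrow> 'a \<Rightarrow> real) \<Rightarrow> bool" where
  "proper_cost c \<longleftrightarrow> transport_cost c \<and>
     (\<exists>K>0. \<forall>x y z. c x y \<le> K * (c x z + c z y)) \<and>
     (\<forall>x0 r. compact {x. c x0 x \<le> r})"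

definition prob_measures :: "'a::topological_space measure set" where
  "prob_measures = {P. prob_space P \<and> sets P = sets (borel :: 'a measure)}"

definition Pc :: "('a::topological_space \<Rightarrow> 'a \<Rightarrow> real) \<Rightarrow> 'a measure set" where
  "Pc c = {P \<in> prob_measures. \<exists>x0. (\<integral>\<^sup>+x. ennreal (c x0 x) \<partial>P) < \<infinity>}"

definition couplings :: "'b measure \<Rightarrow> 'b measure \<Rightarrow> ('b \<times> 'b) measure set" where
  "couplings P1 P2 = {L. sets L = sets (P1 \<Otimes>\<^sub>M P2) \<and>
      distr L P1 fst = P1 \<and> distr L P2 snd = P2}"

definition W :: "('b \<Rightarrow> 'b \<Rightarrow> real) \<Rightarrow> 'b measure \<Rightarrow> 'b measure \<Rightarrow> ennreal" where
  "W c P1 P2 = (INF L\<in>couplings P1 P2. \<integral>\<^sup>+z. ennreal (c (fst z) (snd z)) \<partial>L)"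

(* c^M on X^M, X^M modelled as functions on {..<M} *)
definition costM :: "('a \<Rightarrow> 'a \<Rightarrow> real) \<Rightarrow> nat \<Rightarrow> (nat \<Rightarrow> 'a) \<Rightarrow> (nat \<Rightarrow> 'a) \<Rightarrow> real" where
  "costM c M x y = (\<Sum>i<M. c (x i) (y i))"

definition powM :: "'a measure \<Rightarrow> nat \<Rightarrow> (nat \<Rightarrow> 'a) measure" where
  "powM P M = (\<Pi>\<^sub>M i\<in>{..<M}. P)"

definition mixture :: "'a::topological_space measure measure \<Rightarrow> nat \<Rightarrow> (nat \<Rightarrow> 'a) measure" where
  "mixture \<nu> M = measure_of (space (powM (borel::'a measure) M)) (sets (powM (borel::'a measure) M))
      (\<lambda>A. \<integral>\<^sup>+P. emeasure (powM P M) A \<partial>\<nu>)"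

end

(*
Kantorovich duality for a lower semicontinuous cost c >= 0 gives a countable family of bounded pairs
(f_k, g_k) with f_k(x) + g_k(y) <= c(x,y) such that W_c(P,Q) <= sup_k (int f_k dP + int g_k dQ)
for all P and Q at once.

Upper bound: applied on X^M with cost c^M, the dual functionals are affine in the first marginal, so
W_{c^M} is convex under mixtures without any measurable selection of couplings; a product coupling
bounds the dual value at (P^M, Phat^M) by M W_c(P, Phat).

Lower bound: for any coupling, c^M(x,y)/M dominates the averages of f_k(x_i) + g_k(y_i), for every k.
Take the maximum over k <= N. The y-averages concentrate at int g_k dPhat by the L^2 law of large
numbers, and Jensen's inequality handles the x-averages under P^M. Let M, then N, tend to infinity.

Duality: minimise up to epsilon, over discrete measures pi on X x X, the integral of a truncated cost
plus a quadratic penalty on the masses that the marginals of pi give to basic open sets. The first order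
condition against Dirac masses says that the penalty gradients form an admissible dual pair, so pi is
almost optimal and its marginals are almost right. A limit of such pi exists after coding points by the
basic open sets containing them: Helly's theorem works in the Cantor set, and the limit is decoded by
completeness of X.
*)
theory Submission
  imports Defs
begin

section \<open>Penalised minimisation\<close>

text \<open>Two obstacles shape the duality proof: the marginal constraints involve indicators of
  open sets, which are discontinuous, and the near-minimisers come with no tightness. Both disappear
  in the Cantor set, where membership in a basic set is a coordinate, hence continuous, and
  compactness is automatic. What could be lost there, namely that the limit law sits on codes of
  genuine points, is recovered from its two marginals, which are the laws of the codes of P and Q.
  The penalty is quadratic because its gradient is then a linear combination of indicators of sets
  depending on x alone or on y alone, that is, a function of x plus a function of y. Dual pairs thus
  arise as simple functions, and rounding their coefficients to rationals makes the family countable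
  and independent of P and Q. Both bounds rely on this: integration against \<nu> only meets suprema
  of countably many measurable functionals of P, while P \<mapsto> W_c(P, Phat) itself enters only
  through monotonicity of the integral.\<close>

lemma expectation_bernoulli_mixture:
  fixes f :: "'z \<Rightarrow> real"
  assumes bdd: "\<And>z. \<bar>f z\<bar> \<le> B" and t: "0 \<le> t" "t \<le> 1"
  shows "measure_pmf.expectation (bind_pmf (bernoulli_pmf t) (\<lambda>b. if b then return_pmf z else \<pi>)) f
    = t * f z + (1 - t) * measure_pmf.expectation \<pi> f"
proof -
  have "measure_pmf.expectation (bind_pmf (bernoulli_pmf t) (\<lambda>b. if b then return_pmf z else \<pi>)) f
     = (\<integral>b. measure_pmf.expectation (if b then return_pmf z else \<pi>) f \<partial>bernoulli_pmf t)"
    unfolding measure_pmf_bind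
    by (rule integral_bind[where K="count_space UNIV" and B=B and B'=1])
       (auto simp: bdd measurable_def space_subprob_algebra measure_pmf.finite_measure
         intro!: prob_space_imp_subprob_space measure_pmf.prob_space_axioms)
  then show ?thesis
    using t by simp
qed

text \<open>Let G be the mean of d plus lam/2 times the squared discrepancies. Its derivative from
  \<pi> towards the Dirac mass at z is \<open>d z\<close> minus the mean of d plus lam times the sum
  of \<open>e j * u j\<close>, and near-minimality keeps it above -\<delta>. Splitting
  \<open>u j\<close> as \<open>(h j z - r j) - e j\<close> gives the stated form, in which z occurs
  only through \<open>d z\<close> and a linear combination of the \<open>h j z\<close>.\<close>

lemma penalty_near_minimizer:
  fixes d :: "'z \<Rightarrow> real" and h :: "'j \<Rightarrow> 'z \<Rightarrow> real" and r :: "'j \<Rightarrow> real"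
  assumes J: "finite J"
    and d: "\<And>z. 0 \<le> d z" "\<And>z. d z \<le> B"
    and h: "\<And>j z. 0 \<le> h j z" "\<And>j z. h j z \<le> 1"
    and lam: "0 \<le> lam" and \<delta>: "0 < \<delta>"
  obtains \<pi> :: "'z pmf" where
    "\<And>z. measure_pmf.expectation \<pi> d + lam * (\<Sum>j\<in>J. (measure_pmf.expectation \<pi> (h j) - r j)\<^sup>2) - \<delta>
       \<le> d z + lam * (\<Sum>j\<in>J. (measure_pmf.expectation \<pi> (h j) - r j) * (h j z - r j))"
proof -
  let ?E = "\<lambda>\<pi> f. measure_pmf.expectation \<pi> f"
  define G where "G \<pi> = ?E \<pi> d + lam / 2 * (\<Sum>j\<in>J. (?E \<pi> (h j) - r j)\<^sup>2)" for \<pi>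
  have G0: "0 \<le> G \<pi>" for \<pi>
    unfolding G_def using d lam by (intro add_nonneg_nonneg mult_nonneg_nonneg sum_nonneg integral_nonneg_AE) auto
  \<comment> \<open>An exact minimiser need not exist, so \<pi> is taken optimal up to t squared.
    After division by t, this slack and the second-order term of the penalty cost at most
    \<open>t * (1 + lam * card J)\<close> together.\<close>
  define t where "t = min (1/2) (\<delta> / (1 + lam * card J))"
  have pos: "0 < 1 + lam * card J"
    using lam by (simp add: add_pos_nonneg)
  have t: "0 < t" "t \<le> 1" "t * (1 + lam * card J) \<le> \<delta>"
  proof -
    show "0 < t" "t \<le> 1" using pos \<delta> by (auto simp: t_def)
    have "t \<le> \<delta> / (1 + lam * card J)" by (simp add: t_def)
    then show "t * (1 + lam * card J) \<le> \<delta>" using pos by (simp add: pos_le_divide_eq)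
  qed
  have bdd: "bdd_below (range G)" using G0 by (auto simp: bdd_below_def)
  have "(INF \<pi>. G \<pi>) < (INF \<pi>. G \<pi>) + t\<^sup>2" using t by simp
  then obtain \<pi> where \<pi>: "G \<pi> < (INF \<pi>. G \<pi>) + t\<^sup>2"
    using cINF_less_iff[OF UNIV_not_empty bdd, of "(INF \<pi>. G \<pi>) + t\<^sup>2"] by blast
  have Gle: "G \<pi> < G \<pi>' + t\<^sup>2" for \<pi>'
    using \<pi> cINF_lower[OF bdd, of \<pi>'] by auto
  have Eh: "0 \<le> ?E \<pi> (h j)" "?E \<pi> (h j) \<le> 1" for j
    using h by (auto intro!: integral_nonneg_AE measure_pmf.integral_le_const measure_pmf.integrable_const_bound[where B=1])
  show thesis
  proof (rule that[of \<pi>])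
    fix z
    define \<pi>' where "\<pi>' = bind_pmf (bernoulli_pmf t) (\<lambda>b. if b then return_pmf z else \<pi>)"
    define e where "e j = ?E \<pi> (h j) - r j" for j
    define u where "u j = h j z - ?E \<pi> (h j)" for j
    have u1: "(u j)\<^sup>2 \<le> 1" for j
      using h[of j z] Eh[of j] by (auto simp: u_def abs_square_le_1)
    have Ed': "?E \<pi>' d = t * d z + (1 - t) * ?E \<pi> d"
      unfolding \<pi>'_def using t d by (intro expectation_bernoulli_mixture[where B=B]) (auto simp: abs_le_iff intro: order_trans[of _ 0])
    have Eh': "?E \<pi>' (h j) - r j = e j + t * u j" for j
    proof -
      have "?E \<pi>' (h j) = t * h j z + (1 - t) * ?E \<pi> (h j)"
        unfolding \<pi>'_def using t h by (intro expectation_bernoulli_mixture[where B=1]) (auto simp: abs_le_iff intro: order_trans[of _ 0])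
      then show ?thesis by (simp add: e_def u_def algebra_simps)
    qed
    have "(\<Sum>j\<in>J. (e j + t * u j)\<^sup>2) = (\<Sum>j\<in>J. (e j)\<^sup>2) + 2 * t * (\<Sum>j\<in>J. e j * u j) + t\<^sup>2 * (\<Sum>j\<in>J. (u j)\<^sup>2)"
      by (simp add: power2_sum power_mult_distrib sum.distrib sum_distrib_left algebra_simps)
    moreover have "(\<Sum>j\<in>J. (u j)\<^sup>2) \<le> card J"
      using sum_bounded_above[of J "\<lambda>j. (u j)\<^sup>2" 1] u1 by auto
    ultimately have sq: "(\<Sum>j\<in>J. (e j + t * u j)\<^sup>2) \<le> (\<Sum>j\<in>J. (e j)\<^sup>2) + 2 * t * (\<Sum>j\<in>J. e j * u j) + t\<^sup>2 * card J"
      by (simp add: mult_left_mono)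
    have "G \<pi>' \<le> t * d z + (1 - t) * ?E \<pi> d + lam / 2 * ((\<Sum>j\<in>J. (e j)\<^sup>2) + 2 * t * (\<Sum>j\<in>J. e j * u j) + t\<^sup>2 * card J)"
      unfolding G_def Ed' Eh' using sq lam by (intro add_left_mono mult_left_mono) auto
    with Gle[of \<pi>'] have "G \<pi> < t * d z + (1 - t) * ?E \<pi> d + lam / 2 * ((\<Sum>j\<in>J. (e j)\<^sup>2) + 2 * t * (\<Sum>j\<in>J. e j * u j) + t\<^sup>2 * card J) + t\<^sup>2"
      by linarith
    \<comment> \<open>The terms of order zero in t cancel and a factor t comes out; dividing by it
      leaves the directional derivative and an error of order t.\<close>
    then have "0 < t * (d z - ?E \<pi> d + lam * (\<Sum>j\<in>J. e j * u j) + lam / 2 * t * card J + t)"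
      unfolding G_def e_def[symmetric] by (simp add: algebra_simps power2_eq_square)
    then have "0 < d z - ?E \<pi> d + lam * (\<Sum>j\<in>J. e j * u j) + lam / 2 * t * card J + t"
      using t by (simp add: zero_less_mult_iff)
    moreover have "lam / 2 * t * card J \<le> lam * t * card J" 
      using lam t by (intro mult_right_mono) auto
    moreover have "lam * t * card J + t = t * (1 + lam * card J)" by (simp add: algebra_simps)
    ultimately have "?E \<pi> d - \<delta> \<le> d z + lam * (\<Sum>j\<in>J. e j * u j)" using t(3) by linarith
    moreover have "(\<Sum>j\<in>J. e j * u j) = (\<Sum>j\<in>J. e j * (h j z - r j)) - (\<Sum>j\<in>J. (e j)\<^sup>2)"
      by (simp add: e_def u_def algebra_simps power2_eq_square sum_subtractf[symmetric])
    ultimately show "?E \<pi> d + lam * (\<Sum>j\<in>J. (?E \<pi> (h j) - r j)\<^sup>2) - \<delta>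
       \<le> d z + lam * (\<Sum>j\<in>J. (?E \<pi> (h j) - r j) * (h j z - r j))"
      unfolding e_def[symmetric] by (simp add: right_diff_distrib)
  qed
qed

section \<open>Sequential compactness on the Cantor space\<close>

abbreviation Cantor :: "(nat \<Rightarrow> bool) measure" where
  "Cantor \<equiv> PiM UNIV (\<lambda>_. count_space UNIV)"

text \<open>A Cantor set on the line (digits 0 and 1 in base 3, so with values up to 3/2), through
  which bit sequences become accessible to Helly's theorem. It is meaningful for finite sets only,
  since a sum over an infinite set is 0 by convention.\<close>

definition ternary_code :: "nat set \<Rightarrow> real" where
  "ternary_code A = (\<Sum>k\<in>A. (1/3) ^ k)"

text \<open>Codes never meet the open interval from 1/2 to 1, so the leading digit can be read off by a
  continuous function, which makes it accessible to weak convergence.\<close>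

primrec ternary_digit :: "nat \<Rightarrow> real \<Rightarrow> real" where
  "ternary_digit 0 r = max 0 (min 1 (2 * r - 1))"
| "ternary_digit (Suc k) r = ternary_digit k (3 * (r - max 0 (min 1 (2 * r - 1))))"

lemma ternary_code_bounds:
  assumes "finite A"
  shows "0 \<le> ternary_code A" "ternary_code A \<le> 3/2"
proof -
  show "0 \<le> ternary_code A"
    unfolding ternary_code_def by (intro sum_nonneg) auto
  have s: "(\<lambda>k. (1/3) ^ k :: real) sums (3/2)"
    using geometric_sums[of "1/3::real"] by simp
  have "ternary_code A \<le> (\<Sum>k. (1/3) ^ k)"
    unfolding ternary_code_def using s assms by (intro sum_le_suminf) (auto simp: sums_iff)
  then show "ternary_code A \<le> 3/2"
    using s by (simp add: sums_iff)
qed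

lemma ternary_code_shift:
  assumes "finite A"
  shows "ternary_code A = of_bool (0 \<in> A) + ternary_code {k. Suc k \<in> A} / 3"
proof -
  have A: "A = (if 0 \<in> A then {0} else {}) \<union> Suc ` {k. Suc k \<in> A}"
  proof (intro set_eqI)
    fix k show "k \<in> A \<longleftrightarrow> k \<in> (if 0 \<in> A then {0} else {}) \<union> Suc ` {k. Suc k \<in> A}"
      by (cases k) auto
  qed
  have fin: "finite {k. Suc k \<in> A}"
    using finite_vimageI[OF assms, of Suc] by (simp add: vimage_def)
  have "ternary_code A = (\<Sum>k\<in>(if 0 \<in> A then {0} else {}). (1/3) ^ k) + (\<Sum>k\<in>Suc ` {k. Suc k \<in> A}. (1/3) ^ k)"
  proof -
    have "ternary_code A = (\<Sum>k\<in>(if 0 \<in> A then {0} else {}) \<union> Suc ` {k. Suc k \<in> A}. (1/3) ^ k)"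
      unfolding ternary_code_def using A by (rule arg_cong)
    also have "\<dots> = (\<Sum>k\<in>(if 0 \<in> A then {0} else {}). (1/3) ^ k) + (\<Sum>k\<in>Suc ` {k. Suc k \<in> A}. (1/3) ^ k)"
      using fin by (intro sum.union_disjoint) auto
    finally show ?thesis .
  qed
  also have "(\<Sum>k\<in>Suc ` {k. Suc k \<in> A}. (1/3) ^ k :: real) = ternary_code {k. Suc k \<in> A} / 3"
    by (subst sum.reindex) (auto simp: ternary_code_def sum_divide_distrib)
  finally show ?thesis by simp
qed

lemma ternary_leading_digit:
  assumes "finite A"
  shows "max 0 (min 1 (2 * ternary_code A - 1)) = of_bool (0 \<in> A)"
proof -
  have "finite {k. Suc k \<in> A}"
    using finite_vimageI[OF assms, of Suc] by (simp add: vimage_def)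
  note ternary_code_bounds[OF this]
  then show ?thesis
    using ternary_code_shift[OF assms] by (cases "0 \<in> A") (simp_all add: max_def min_def)
qed

text \<open>Removing the leading digit and multiplying by 3 turns the code of A into that of
  \<open>{k. Suc k \<in> A}\<close>, which is why the induction has to range over all A.\<close>

lemma ternary_digit_code:
  "finite A \<Longrightarrow> ternary_digit k (ternary_code A) = of_bool (k \<in> A)"
proof (induction k arbitrary: A)
  case 0
  then show ?case using ternary_leading_digit by simp
next
  case (Suc k)
  have "finite {k. Suc k \<in> A}"
    using finite_vimageI[OF Suc.prems, of Suc] by (simp add: vimage_def)
  moreover have "3 * (ternary_code A - max 0 (min 1 (2 * ternary_code A - 1))) = ternary_code {k. Suc k \<in> A}"
    unfolding ternary_leading_digit[OF Suc.prems] using ternary_code_shift[OF Suc.prems] by (simp add: field_simps)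
  ultimately show ?case
    using Suc.IH[of "{k. Suc k \<in> A}"] by (simp only: ternary_digit.simps mem_Collect_eq)
qed

lemma continuous_on_ternary_digit [continuous_intros]:
  "continuous_on S f \<Longrightarrow> continuous_on S (\<lambda>x. ternary_digit k (f x))"
proof (induction k arbitrary: f)
  case 0
  then show ?case unfolding ternary_digit.simps by (intro continuous_intros)
next
  case (Suc k)
  show ?case unfolding ternary_digit.simps
    by (rule Suc.IH) (intro continuous_intros Suc.prems)
qed

lemma ternary_digit_range: "0 \<le> ternary_digit k r" "ternary_digit k r \<le> 1"
proof (induction k arbitrary: r)
  case (Suc k)
  {
    case 1 show ?case unfolding ternary_digit.simps by (rule Suc.IH)
  next
    case 2 show ?case unfolding ternary_digit.simps by (rule Suc.IH)
  }
qed simp_all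

lemma borel_measurable_ternary_digit [measurable]: "ternary_digit k \<in> borel_measurable borel"
  using continuous_on_ternary_digit[OF continuous_on_id] by (intro borel_measurable_continuous_onI) simp

text \<open>On 0/1 values the products form a partition of unity indexed by the subsets of K, and
  exactly one of them is nonzero. Hence a function of finitely many bits is a polynomial in them,
  which yields its measurability and later its continuous extension to the line.\<close>

lemma subset_product_collapse:
  fixes \<Phi> :: "nat set \<Rightarrow> real"
  assumes "finite K"
  shows "(\<Sum>S\<in>Pow K. \<Phi> S * (\<Prod>k\<in>K. if k \<in> S then of_bool (P k) else 1 - of_bool (P k))) = \<Phi> {k\<in>K. P k}"
proof -
  have "(\<Prod>k\<in>K. if k \<in> S then of_bool (P k) else 1 - of_bool (P k)) = (of_bool (S = {k\<in>K. P k}) :: real)"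
    if "S \<in> Pow K" for S
  proof (cases "S = {k\<in>K. P k}")
    case False
    then have "\<exists>k\<in>K. (k \<in> S) \<noteq> P k" using that by blast
    then obtain k where "k \<in> K" "k \<in> S \<longleftrightarrow> \<not> P k" by blast
    then have "(\<Prod>k\<in>K. if k \<in> S then of_bool (P k) else 1 - of_bool (P k)) = (0::real)"
      using assms by (intro prod_zero) (auto intro!: bexI[of _ k])
    then show ?thesis using False by simp
  qed (auto intro!: prod.neutral)
  then have "(\<Sum>S\<in>Pow K. \<Phi> S * (\<Prod>k\<in>K. if k \<in> S then of_bool (P k) else 1 - of_bool (P k)))
     = (\<Sum>S\<in>Pow K. if S = {k\<in>K. P k} then \<Phi> S else 0)"
    by (intro sum.cong) auto
  also have "\<dots> = \<Phi> {k\<in>K. P k}"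
    using assms by (subst sum.delta) auto
  finally show ?thesis .
qed

lemma cylinder_function_measurable:
  fixes \<Phi> :: "(nat \<Rightarrow> bool) \<Rightarrow> real"
  assumes "\<And>\<omega> \<omega>'. (\<And>k. k < N \<Longrightarrow> \<omega> k = \<omega>' k) \<Longrightarrow> \<Phi> \<omega> = \<Phi> \<omega>'"
  shows "\<Phi> \<in> borel_measurable Cantor"
proof -
  have *: "\<Phi> w = (\<Sum>S\<in>Pow {..<N}. \<Phi> (\<lambda>k. k \<in> S) *
     (\<Prod>k\<in>{..<N}. if k \<in> S then of_bool (w k) else 1 - of_bool (w k)))" for w
    by (subst subset_product_collapse[where \<Phi>="\<lambda>S. \<Phi> (\<lambda>k. k \<in> S)"]) (auto intro: assms)
  show ?thesis
    by (subst *[abs_def]) measurable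
qed

text \<open>The codes of the bit sequences stay in a bounded interval, so their laws are tight and a
  subsequence converges weakly. A function of finitely many bits is a polynomial in the digits,
  hence a bounded continuous function of the code, so its expectations converge as well.\<close>

lemma Cantor_space_seq_compact:
  fixes \<pi> :: "nat \<Rightarrow> 'z pmf" and V :: "nat \<Rightarrow> 'z set"
  obtains s :: "nat \<Rightarrow> nat" and M :: "(nat \<Rightarrow> bool) measure" where
    "strict_mono s" "prob_space M" "sets M = sets Cantor"
    "\<And>(N::nat) (\<Phi> :: (nat \<Rightarrow> bool) \<Rightarrow> real).
       (\<And>\<omega> \<omega>'. (\<And>k. k < N \<Longrightarrow> \<omega> k = \<omega>' k) \<Longrightarrow> \<Phi> \<omega> = \<Phi> \<omega>') \<Longrightarrow>
       (\<lambda>n. measure_pmf.expectation (\<pi> (s n)) (\<lambda>z. \<Phi> (\<lambda>k. z \<in> V k))) \<longlonglongrightarrow> (\<integral>\<omega>. \<Phi> \<omega> \<partial>M)"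
proof -
  \<comment> \<open>Only the first n bits are coded at stage n, to keep the coded set finite. Since
    \<open>n \<le> s n\<close>, a function of the first N bits is unaffected once
    \<open>n \<ge> N\<close>.\<close>
  define h where "h n z = ternary_code {k. k < n \<and> z \<in> V k}" for n z
  define \<mu> where "\<mu> n = distr (measure_pmf (\<pi> n)) borel (h n)" for n
  have rd: "real_distribution (\<mu> n)" for n
    unfolding \<mu>_def by (rule prob_space.real_distribution_distr[OF measure_pmf.prob_space_axioms]) simp
  have hb: "0 \<le> h n z" "h n z \<le> 3/2" for n z
    unfolding h_def using ternary_code_bounds[of "{k. k < n \<and> z \<in> V k}"] by auto
  have m1: "measure (\<mu> n) {-1<..2} = 1" for n
  proof -
    have "h n -` {-1<..2} = UNIV" using hb[of n] by (auto simp: less_le_trans[of _ 0] order_trans[of _ "3/2"])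
    then show ?thesis by (simp add: \<mu>_def measure_distr)
  qed
  have "tight \<mu>"
    unfolding tight_def
  proof (intro conjI allI impI)
    fix \<epsilon> :: real assume "0 < \<epsilon>"
    then have "(-1::real) < 2 \<and> (\<forall>n. 1 - \<epsilon> < measure (\<mu> n) {-1<..2})" using m1 by simp
    then show "\<exists>a b. a < b \<and> (\<forall>n. 1 - \<epsilon> < measure (\<mu> n) {a<..b})" by blast
  qed (rule rd)
  from tight_imp_convergent_subsubsequence[OF this strict_mono_id]
  obtain s \<mu>' where s: "strict_mono s" and rd': "real_distribution \<mu>'" and wc: "weak_conv_m (\<mu> \<circ> s) \<mu>'"
    by (auto simp: comp_def id_def)
  interpret \<mu>': real_distribution \<mu>' by fact
  have conv: "(\<lambda>n. measure_pmf.expectation (\<pi> (s n)) (\<lambda>z. f (h (s n) z))) \<longlonglongrightarrow> integral\<^sup>L \<mu>' f"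
    if f: "continuous_on UNIV f" "\<And>x. \<bar>f x\<bar> \<le> B" for f :: "real \<Rightarrow> real" and B
  proof -
    have "(\<lambda>n. integral\<^sup>L ((\<mu> \<circ> s) n) f) \<longlonglongrightarrow> integral\<^sup>L \<mu>' f"
      using wc rd rd' f by (intro weak_conv_imp_integral_bdd_continuous_conv[where B=B])
        (auto simp: continuous_on_eq_continuous_at comp_def)
    moreover have "integral\<^sup>L ((\<mu> \<circ> s) n) f = measure_pmf.expectation (\<pi> (s n)) (\<lambda>z. f (h (s n) z))" for n
      unfolding \<mu>_def comp_def using f(1) by (intro integral_distr) (auto intro: borel_measurable_continuous_onI)
    ultimately show ?thesis by simp
  qed
  have digit: "ternary_digit k (h n z) = of_bool (k < n \<and> z \<in> V k)" for k n z
    unfolding h_def by (subst ternary_digit_code) auto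
  have sge: "n \<le> s n" for n using s by (rule strict_mono_imp_increasing)
  \<comment> \<open>The limit could a priori charge points whose digits lie strictly between 0 and
    1. The continuous function \<open>?f\<close> vanishes on every code, so its integral in the
    limit is 0, and as it is nonnegative the digits are almost surely 0 or 1.\<close>
  have AE01: "AE r in \<mu>'. ternary_digit k r = of_bool (1/2 < ternary_digit k r)" for k
  proof -
    let ?f = "\<lambda>r. ternary_digit k r * (1 - ternary_digit k r)"
    have f: "0 \<le> ?f r" "\<bar>?f r\<bar> \<le> 1" for r
      using ternary_digit_range[of k r] by (auto simp: abs_mult mult_le_one)
    have *: "(\<lambda>n. measure_pmf.expectation (\<pi> (s n)) (\<lambda>z. ?f (h (s n) z))) \<longlonglongrightarrow> integral\<^sup>L \<mu>' ?f"
      by (rule conv[OF _ f(2)]) (auto intro!: continuous_intros)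
    have "integral\<^sup>L \<mu>' ?f = 0"
    proof -
      have "of_bool p * (1 - of_bool p) = (0::real)" for p by (cases p) auto
      with * show ?thesis unfolding digit by (simp add: LIMSEQ_const_iff)
    qed
    moreover have "integrable \<mu>' ?f"
      using f by (intro \<mu>'.integrable_const_bound[where B=1]) auto
    ultimately have "AE r in \<mu>'. ?f r = 0"
      using f by (subst integral_nonneg_eq_0_iff_AE[symmetric]) auto
    then show ?thesis by eventually_elim auto
  qed
  define \<omega> where "\<omega> r = (\<lambda>k. 1/2 < ternary_digit k r)" for r
  have [measurable]: "\<omega> \<in> \<mu>' \<rightarrow>\<^sub>M Cantor"
    unfolding \<omega>_def by (rule measurable_PiM_single') auto
  define M where "M = distr \<mu>' Cantor \<omega>"
  show thesis
  proof (rule that[of s M])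
    show "strict_mono s" by fact
    show "prob_space M" unfolding M_def by (rule \<mu>'.prob_space_distr) simp
    show "sets M = sets Cantor" by (simp add: M_def)
    fix N :: nat and \<Phi> :: "(nat \<Rightarrow> bool) \<Rightarrow> real"
    assume \<Phi>: "\<And>\<omega> \<omega>'. (\<And>k. k < N \<Longrightarrow> \<omega> k = \<omega>' k) \<Longrightarrow> \<Phi> \<omega> = \<Phi> \<omega>'"
    have \<Phi>m: "\<Phi> \<in> borel_measurable Cantor"
      using \<Phi> by (rule cylinder_function_measurable)
    \<comment> \<open>The multilinear extension of \<Phi>, with bits replaced by the continuous
      digit functions: it agrees with \<Phi> wherever the first N digits are 0 or 1.\<close>
    define \<Psi> where "\<Psi> r = (\<Sum>S\<in>Pow {..<N}. \<Phi> (\<lambda>k. k \<in> S) *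
       (\<Prod>k\<in>{..<N}. if k \<in> S then ternary_digit k r else 1 - ternary_digit k r))" for r
    have \<Psi>eq: "\<Psi> r = \<Phi> P" if "\<And>k. k < N \<Longrightarrow> ternary_digit k r = of_bool (P k)" for r P
    proof -
      have "\<Psi> r = (\<Sum>S\<in>Pow {..<N}. \<Phi> (\<lambda>k. k \<in> S) *
         (\<Prod>k\<in>{..<N}. if k \<in> S then of_bool (P k) else 1 - of_bool (P k)))"
        unfolding \<Psi>_def using that by (intro sum.cong arg_cong2[where f="(*)"] prod.cong) auto
      also have "\<dots> = \<Phi> (\<lambda>k. k \<in> {k\<in>{..<N}. P k})"
        by (rule subset_product_collapse[where \<Phi>="\<lambda>S. \<Phi> (\<lambda>k. k \<in> S)"]) simp
      also have "\<dots> = \<Phi> P" by (rule \<Phi>) auto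
      finally show ?thesis .
    qed
    have "continuous_on UNIV (\<lambda>r. if k \<in> S then ternary_digit k r else 1 - ternary_digit k r)" for k S
      by (cases "k \<in> S") (auto intro!: continuous_intros)
    then have cont: "continuous_on UNIV \<Psi>"
      unfolding \<Psi>_def by (intro continuous_intros)
    have bdd: "\<bar>\<Psi> r\<bar> \<le> (\<Sum>S\<in>Pow {..<N}. \<bar>\<Phi> (\<lambda>k. k \<in> S)\<bar>)" for r
    proof -
      have "\<bar>\<Psi> r\<bar> \<le> (\<Sum>S\<in>Pow {..<N}. \<bar>\<Phi> (\<lambda>k. k \<in> S) *
         (\<Prod>k\<in>{..<N}. if k \<in> S then ternary_digit k r else 1 - ternary_digit k r)\<bar>)"
        unfolding \<Psi>_def by (rule sum_abs)
      also have "\<dots> \<le> (\<Sum>S\<in>Pow {..<N}. \<bar>\<Phi> (\<lambda>k. k \<in> S)\<bar> * 1)"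
        unfolding abs_mult abs_prod using ternary_digit_range
        by (intro sum_mono mult_left_mono prod_le_1) auto
      finally show ?thesis by simp
    qed
    have "AE r in \<mu>'. \<forall>k. ternary_digit k r = of_bool (\<omega> r k)"
      unfolding \<omega>_def AE_all_countable using AE01 by auto
    then have "integral\<^sup>L \<mu>' \<Psi> = (\<integral>r. \<Phi> (\<omega> r) \<partial>\<mu>')"
    proof (intro integral_cong_AE)
      show "\<Psi> \<in> borel_measurable \<mu>'" using cont by (simp add: borel_measurable_continuous_onI)
      show "(\<lambda>r. \<Phi> (\<omega> r)) \<in> borel_measurable \<mu>'"
        by (rule measurable_compose[OF _ \<Phi>m]) auto
    qed (auto elim!: eventually_mono intro!: \<Psi>eq)
    also have "\<dots> = (\<integral>\<omega>. \<Phi> \<omega> \<partial>M)"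
      unfolding M_def using \<Phi>m by (intro integral_distr[symmetric]) auto
    finally have lim: "integral\<^sup>L \<mu>' \<Psi> = (\<integral>\<omega>. \<Phi> \<omega> \<partial>M)" .
    have "eventually (\<lambda>n. measure_pmf.expectation (\<pi> (s n)) (\<lambda>z. \<Psi> (h (s n) z))
       = measure_pmf.expectation (\<pi> (s n)) (\<lambda>z. \<Phi> (\<lambda>k. z \<in> V k))) sequentially"
      using eventually_ge_at_top[of N]
    proof eventually_elim
      case (elim n)
      show ?case
        using sge[of n] elim by (intro Bochner_Integration.integral_cong refl \<Psi>eq) (auto simp: digit)
    qed
    then show "(\<lambda>n. measure_pmf.expectation (\<pi> (s n)) (\<lambda>z. \<Phi> (\<lambda>k. z \<in> V k))) \<longlonglongrightarrow> (\<integral>\<omega>. \<Phi> \<omega> \<partial>M)"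
      using conv[OF cont bdd] unfolding lim by (rule Lim_transform_eventually[rotated])
  qed
qed

section \<open>Limits of almost-couplings\<close>

text \<open>At precision m, take the first basic set that has its bit set and fits in a ball of
  radius 1/(m+1), and choose a point of it. If the bits are the code of x, that point is within
  2/(m+1) of x; completeness supplies limits for the remaining Cauchy sequences.\<close>

lemma Cantor_decoding:
  fixes U :: "nat \<Rightarrow> 'b::polish_space set"
  assumes basis: "topological_basis (range U)"
  obtains \<psi> where "\<psi> \<in> Cantor \<rightarrow>\<^sub>M borel" "\<And>x. \<psi> (\<lambda>k. x \<in> U k) = x"
proof -
  define good where "good m i \<longleftrightarrow> (\<exists>w. U i \<subseteq> ball w (1 / Suc m))" for m i
  \<comment> \<open>The chosen point depends on \<omega> only through a natural number, so
    measurability is that of the least index. On bit sequences that select no good set the value is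
    arbitrary, which is harmless.\<close>
  define f where "f m \<omega> = (SOME z. z \<in> U (LEAST i. \<omega> i \<and> good m i))" for m \<omega>
  have f[measurable]: "f m \<in> Cantor \<rightarrow>\<^sub>M borel" for m
  proof -
    have "(\<lambda>\<omega>. LEAST i. \<omega> i \<and> good m i) \<in> Cantor \<rightarrow>\<^sub>M count_space UNIV" by measurable
    then show ?thesis unfolding f_def by (rule measurable_compose) simp
  qed
  \<comment> \<open>Non-Cauchy sequences are replaced by a constant one, so that the limit exists at
    every \<omega> and \<psi> is a pointwise limit of measurable maps.\<close>
  define g where "g m \<omega> = (if Cauchy (\<lambda>m. f m \<omega>) then f m \<omega> else undefined)" for m \<omega>
  have g[measurable]: "g m \<in> Cantor \<rightarrow>\<^sub>M borel" for m
    unfolding g_def by measurable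
  define \<psi> where "\<psi> \<omega> = lim (\<lambda>m. g m \<omega>)" for \<omega>
  have lim: "(\<lambda>m. g m \<omega>) \<longlonglongrightarrow> \<psi> \<omega>" for \<omega>
  proof -
    have "convergent (\<lambda>m. g m \<omega>)"
    proof (cases "Cauchy (\<lambda>m. f m \<omega>)")
      case True
      then show ?thesis unfolding g_def by (simp add: Cauchy_convergent_iff)
    next
      case False
      then show ?thesis unfolding g_def by (simp add: convergent_const)
    qed
    then show ?thesis unfolding \<psi>_def by (rule convergent_LIMSEQ_iff[THEN iffD1])
  qed
  have meas: "\<psi> \<in> Cantor \<rightarrow>\<^sub>M borel"
    by (rule borel_measurable_LIMSEQ_metric[OF g lim])
  have dec: "\<psi> (\<lambda>k. x \<in> U k) = x" for x
  proof -
    let ?\<omega> = "\<lambda>k. x \<in> U k"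
    have near: "dist (f m ?\<omega>) x \<le> 2 / Suc m" for m
    proof -
      define i where "i = (LEAST i. x \<in> U i \<and> good m i)"
      obtain B where "B \<in> range U" "x \<in> B" "B \<subseteq> ball x (1 / Suc m)"
        by (rule topological_basisE[OF basis open_ball, of x x "1 / Suc m"]) simp
      then have "\<exists>i. x \<in> U i \<and> good m i" unfolding good_def by blast
      from LeastI_ex[OF this] have i: "x \<in> U i" "good m i" unfolding i_def by auto
      have "f m ?\<omega> \<in> U i" unfolding f_def i_def[symmetric] using i(1) by (rule someI)
      moreover obtain w where w: "U i \<subseteq> ball w (1 / Suc m)" using i(2) unfolding good_def by blast
      ultimately have d: "dist w (f m ?\<omega>) < 1 / Suc m" "dist w x < 1 / Suc m"
        using i(1) by (meson mem_ball subsetD)+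
      have "dist (f m ?\<omega>) x < 1 / Suc m + 1 / Suc m"
        by (rule le_less_trans[OF dist_triangle3 add_strict_mono[OF d]])
      then show ?thesis
        unfolding add_divide_distrib[symmetric] one_add_one by (rule less_imp_le)
    qed
    have "(\<lambda>m. 2 / Suc m) \<longlonglongrightarrow> (0::real)"
      using LIMSEQ_Suc[OF lim_const_over_n[of "2::real"]] .
    moreover have "norm (dist (f m ?\<omega>) x) \<le> 2 / Suc m" for m
      unfolding real_norm_def abs_of_nonneg[OF zero_le_dist] by (rule near)
    ultimately have "(\<lambda>m. dist (f m ?\<omega>) x) \<longlonglongrightarrow> 0"
      by (rule Lim_null_comparison[OF always_eventually[OF allI], rotated])
    then have l: "(\<lambda>m. f m ?\<omega>) \<longlonglongrightarrow> x" by (rule tendsto_dist_iff[THEN iffD2])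
    then have "Cauchy (\<lambda>m. f m ?\<omega>)" by (rule LIMSEQ_imp_Cauchy)
    then have "g m ?\<omega> = f m ?\<omega>" for m unfolding g_def by (rule if_P)
    then have "(\<lambda>m. g m ?\<omega>) \<longlonglongrightarrow> x" using l by (simp only:)
    then show ?thesis by (rule LIMSEQ_unique[OF lim])
  qed
  show thesis by (rule that[OF meas dec])
qed

text \<open>Prescribing true bits alone is enough: these events are stable under intersection, and
  already the single conditions \<open>\<omega> i\<close> generate the sigma-algebra. For codes of
  points such an event is an intersection of basic sets, which is why the basis is taken stable
  under intersection.\<close>

lemma measure_eqI_Cantor:
  assumes "prob_space M" "prob_space N" "sets M = sets Cantor" "sets N = sets Cantor"
    and eq: "\<And>F. finite F \<Longrightarrow> measure M {\<omega>. \<forall>i\<in>F. \<omega> i} = measure N {\<omega>. \<forall>i\<in>F. \<omega> i}"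
  shows "M = N"
proof -
  interpret M: prob_space M by fact
  interpret N: prob_space N by fact
  define G where "G = {{\<omega>::nat \<Rightarrow> bool. \<forall>i\<in>F. \<omega> i} |F. finite F}"
  have sp: "space Cantor = UNIV" by (simp add: space_PiM)
  have GC: "G \<subseteq> sets Cantor"
  proof
    fix X assume "X \<in> G"
    then obtain F where F: "finite F" "X = {\<omega>. \<forall>i\<in>F. \<omega> i}" by (auto simp: G_def)
    have "{\<omega>\<in>space Cantor. \<forall>i\<in>F. \<omega> i} \<in> sets Cantor" using F(1) by measurable
    then show "X \<in> sets Cantor" by (simp add: F sp)
  qed
  have "(\<lambda>\<omega>. \<omega>) \<in> sigma UNIV G \<rightarrow>\<^sub>M Cantor"
  proof (rule measurable_PiM_single')
    fix i :: nat
    have "{\<omega>. \<omega> i} \<in> G" unfolding G_def by (auto intro!: exI[of _ "{i}"])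
    then show "(\<lambda>\<omega>. \<omega> i) \<in> sigma UNIV G \<rightarrow>\<^sub>M count_space UNIV"
      by (intro pred_def[THEN iffD2]) auto
  qed auto
  then have "sets Cantor \<subseteq> sigma_sets UNIV G"
    using measurable_sets[of "\<lambda>\<omega>. \<omega>" "sigma UNIV G" Cantor] by auto
  moreover have "sigma_sets UNIV G \<subseteq> sets Cantor"
    using GC sets.sigma_sets_subset[of G Cantor] by (simp add: sp)
  ultimately have sets: "sets Cantor = sigma_sets UNIV G" by auto
  show ?thesis
  proof (rule measure_eqI_generator_eq[where E=G and \<Omega>=UNIV and A="\<lambda>_. UNIV"])
    show "Int_stable G"
    proof (rule Int_stableI)
      fix a b assume "a \<in> G" "b \<in> G"
      then obtain A B where "finite A" "finite B" "a = {\<omega>. \<forall>i\<in>A. \<omega> i}" "b = {\<omega>. \<forall>i\<in>B. \<omega> i}" by (auto simp: G_def)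
      then have "a \<inter> b = {\<omega>. \<forall>i\<in>A\<union>B. \<omega> i}" "finite (A \<union> B)" by auto
      then show "a \<inter> b \<in> G" unfolding G_def by blast
    qed
    show "range (\<lambda>_. UNIV) \<subseteq> G" unfolding G_def by (auto intro!: exI[of _ "{}"])
    fix X assume "X \<in> G"
    then show "emeasure M X = emeasure N X"
      using eq by (auto simp: G_def M.emeasure_eq_measure N.emeasure_eq_measure)
  qed (use assms sets in auto)
qed

text \<open>Even coordinates code the first component of a pair, odd coordinates the second.\<close>

definition strip :: "(nat \<Rightarrow> 'b set) \<Rightarrow> nat \<Rightarrow> ('b \<times> 'b) set" where
  "strip U k = (if even k then U (k div 2) \<times> UNIV else UNIV \<times> U (k div 2))"

lemma in_strip_simps [simp]:
  "z \<in> strip U (2 * k) \<longleftrightarrow> fst z \<in> U k" "z \<in> strip U (Suc (2 * k)) \<longleftrightarrow> snd z \<in> U k"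
  by (auto simp: strip_def mem_Times_iff)

lemma finite_Inter_in_range:
  fixes U :: "nat \<Rightarrow> 'b set"
  assumes "\<And>i j. U i \<inter> U j \<in> range U" "UNIV \<in> range U" "finite F"
  shows "\<exists>k. U k = {x. \<forall>i\<in>F. x \<in> U i}"
  using assms(3)
proof induction
  case empty
  then show ?case using assms(2) by auto
next
  case (insert i F)
  then obtain k where k: "U k = {x. \<forall>i\<in>F. x \<in> U i}" by auto
  obtain l where "U l = U i \<inter> U k" using assms(1)[of i k] by auto
  then have "U l = {x. \<forall>i\<in>insert i F. x \<in> U i}" using k by auto
  then show ?case by blast
qed

text \<open>The even and the odd coordinates of the Cantor limit have the laws of the codes of
  P-random and Q-random points. Hence almost every \<omega> is the code of the pair it decodes to,
  so decoding produces the right marginals and leaves integrals of cylinder functions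
  unchanged.\<close>

lemma couplings_limit:
  fixes U :: "nat \<Rightarrow> 'b::polish_space set" and \<pi> :: "nat \<Rightarrow> ('b \<times> 'b) pmf"
  assumes basis: "topological_basis (range U)"
    and int: "\<And>i j. U i \<inter> U j \<in> range U" and univ: "UNIV \<in> range U"
    and P: "P \<in> prob_measures" and Q: "Q \<in> prob_measures"
    and limP: "\<And>k. (\<lambda>n. measure_pmf.expectation (\<pi> n) (\<lambda>z. of_bool (fst z \<in> U k))) \<longlonglongrightarrow> measure P (U k)"
    and limQ: "\<And>k. (\<lambda>n. measure_pmf.expectation (\<pi> n) (\<lambda>z. of_bool (snd z \<in> U k))) \<longlonglongrightarrow> measure Q (U k)"
  obtains s :: "nat \<Rightarrow> nat" and L where "strict_mono s" "L \<in> couplings P Q"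
    "\<And>(N::nat) (\<Phi> :: (nat \<Rightarrow> bool) \<Rightarrow> real).
       (\<And>\<omega> \<omega>'. (\<And>k. k < N \<Longrightarrow> \<omega> k = \<omega>' k) \<Longrightarrow> \<Phi> \<omega> = \<Phi> \<omega>') \<Longrightarrow>
       (\<lambda>n. measure_pmf.expectation (\<pi> (s n)) (\<lambda>z. \<Phi> (\<lambda>k. z \<in> strip U k)))
         \<longlonglongrightarrow> (\<integral>z. \<Phi> (\<lambda>k. z \<in> strip U k) \<partial>L)"
proof -
  obtain \<psi> where [measurable]: "\<psi> \<in> Cantor \<rightarrow>\<^sub>M borel" and \<psi>: "\<And>x. \<psi> (\<lambda>k. x \<in> U k) = x"
    using Cantor_decoding[OF basis] by blast
  obtain s M where s: "strict_mono s" and M: "prob_space M" "sets M = sets Cantor"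
    and conv: "\<And>(N::nat) (\<Phi> :: (nat \<Rightarrow> bool) \<Rightarrow> real).
       (\<And>\<omega> \<omega>'. (\<And>k. k < N \<Longrightarrow> \<omega> k = \<omega>' k) \<Longrightarrow> \<Phi> \<omega> = \<Phi> \<omega>') \<Longrightarrow>
       (\<lambda>n. measure_pmf.expectation (\<pi> (s n)) (\<lambda>z. \<Phi> (\<lambda>k. z \<in> strip U k))) \<longlonglongrightarrow> (\<integral>\<omega>. \<Phi> \<omega> \<partial>M)"
    using Cantor_space_seq_compact[of \<pi> "strip U"] by blast
  interpret M: prob_space M by fact
  note [measurable_cong] = M(2)
  have spM: "space M = UNIV" using sets_eq_imp_space_eq[OF M(2)] by (simp add: space_PiM)
  have Uo[measurable]: "U k \<in> sets borel" for k
    using topological_basis_open[OF basis] by auto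
  have [measurable]: "(\<lambda>x k. x \<in> U k) \<in> borel \<rightarrow>\<^sub>M Cantor"
    by (rule measurable_PiM_single') auto
  \<comment> \<open>Here \<open>p\<close> stands for \<open>fst\<close> or \<open>snd\<close>, and
    \<open>\<iota>\<close> for the matching embedding of coordinates. All bits in F being set means
    that \<open>p z\<close> lies in one basic set, whose mass converges by assumption.\<close>
  have marg: "distr M Cantor (\<lambda>\<omega> k. \<omega> (\<iota> k)) = distr R Cantor (\<lambda>x k. x \<in> U k)" 
    if R: "R \<in> prob_measures"
      and lim: "\<And>k. (\<lambda>n. measure_pmf.expectation (\<pi> n) (\<lambda>z. of_bool (p z \<in> U k))) \<longlonglongrightarrow> measure R (U k)"
      and \<iota>: "\<And>z k. z \<in> strip U (\<iota> k) \<longleftrightarrow> p z \<in> U k"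
    for R p and \<iota> :: "nat \<Rightarrow> nat"
  proof -
    interpret R: prob_space R using R by (simp add: prob_measures_def)
    have [measurable_cong]: "sets R = sets borel" using R by (simp add: prob_measures_def)
    have spR: "space R = UNIV" using sets_eq_imp_space_eq[OF \<open>sets R = sets borel\<close>] by simp
    have [measurable]: "(\<lambda>\<omega> k. \<omega> (\<iota> k)) \<in> Cantor \<rightarrow>\<^sub>M Cantor"
      by (rule measurable_PiM_single') auto
    show ?thesis
    proof (rule measure_eqI_Cantor)
      fix F :: "nat set" assume F: "finite F"
      obtain k where k: "U k = {x. \<forall>i\<in>F. x \<in> U i}"
        using finite_Inter_in_range[OF int univ F] by auto
      have mF: "{\<omega>. \<forall>i\<in>F. \<omega> i} \<in> sets Cantor"
      proof -
        have "{\<omega>\<in>space Cantor. \<forall>i\<in>F. \<omega> i} \<in> sets Cantor" using F by measurable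
        then show ?thesis by (simp add: space_PiM)
      qed
      let ?\<Phi> = "\<lambda>\<omega>. of_bool (\<forall>i\<in>F. \<omega> (\<iota> i)) :: real"
      have "(\<lambda>n. measure_pmf.expectation (\<pi> (s n)) (\<lambda>z. ?\<Phi> (\<lambda>k. z \<in> strip U k))) \<longlonglongrightarrow> (\<integral>\<omega>. ?\<Phi> \<omega> \<partial>M)"
      proof (rule conv[where N="Suc (Max (\<iota> ` F))"])
        fix \<omega> \<omega>' :: "nat \<Rightarrow> bool" assume "\<And>k. k < Suc (Max (\<iota> ` F)) \<Longrightarrow> \<omega> k = \<omega>' k"
        then have "\<omega> (\<iota> i) = \<omega>' (\<iota> i)" if "i \<in> F" for i using F that by (simp add: less_Suc_eq_le)
        then show "?\<Phi> \<omega> = ?\<Phi> \<omega>'" by simp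
      qed
      moreover have "?\<Phi> (\<lambda>k. z \<in> strip U k) = of_bool (p z \<in> U k)" for z
        unfolding \<iota> k by simp
      ultimately have "(\<lambda>n. measure_pmf.expectation (\<pi> (s n)) (\<lambda>z. of_bool (p z \<in> U k))) \<longlonglongrightarrow> (\<integral>\<omega>. ?\<Phi> \<omega> \<partial>M)"
        by simp
      then have "(\<integral>\<omega>. ?\<Phi> \<omega> \<partial>M) = measure R (U k)"
        using LIMSEQ_subseq_LIMSEQ[OF lim s, of k] LIMSEQ_unique by (auto simp: comp_def)
      also have "(\<integral>\<omega>. ?\<Phi> \<omega> \<partial>M) = measure M {\<omega>. \<forall>i\<in>F. \<omega> (\<iota> i)}"
      proof -
        have "?\<Phi> = indicator {\<omega>. \<forall>i\<in>F. \<omega> (\<iota> i)}" by (auto simp: indicator_def)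
        then show ?thesis by (simp add: spM)
      qed
      finally show "measure (distr M Cantor (\<lambda>\<omega> k. \<omega> (\<iota> k))) {\<omega>. \<forall>i\<in>F. \<omega> i}
          = measure (distr R Cantor (\<lambda>x k. x \<in> U k)) {\<omega>. \<forall>i\<in>F. \<omega> i}"
        using mF by (simp add: measure_distr spM spR k vimage_def)
    qed (auto intro!: M.prob_space_distr R.prob_space_distr)
  qed
  have mP: "distr M Cantor (\<lambda>\<omega> k. \<omega> (2 * k)) = distr P Cantor (\<lambda>x k. x \<in> U k)"
    by (rule marg[OF P limP]) simp
  have mQ: "distr M Cantor (\<lambda>\<omega> k. \<omega> (Suc (2 * k))) = distr Q Cantor (\<lambda>x k. x \<in> U k)"
    by (rule marg[OF Q limQ]) simp
  have [measurable_cong]: "sets P = sets borel" "sets Q = sets borel"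
    using P Q by (auto simp: prob_measures_def)
  have [measurable]: "(\<lambda>\<omega> k. \<omega> (2 * k)) \<in> Cantor \<rightarrow>\<^sub>M Cantor" "(\<lambda>\<omega> k. \<omega> (Suc (2 * k))) \<in> Cantor \<rightarrow>\<^sub>M Cantor"
    by (auto intro!: measurable_PiM_single')
  define z where "z \<omega> = (\<psi> (\<lambda>k. \<omega> (2 * k)), \<psi> (\<lambda>k. \<omega> (Suc (2 * k))))" for \<omega>
  have [measurable]: "z \<in> Cantor \<rightarrow>\<^sub>M borel \<Otimes>\<^sub>M borel"
    unfolding z_def by measurable
  define L where "L = distr M (borel \<Otimes>\<^sub>M borel) z"
  \<comment> \<open>Equality of laws transports both facts from actual codes, where \<psi> is a left
    inverse of the coding map and hence every bit agrees with membership of the decoded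
    point.\<close>
  have dec: "distr M borel (\<lambda>\<omega>. \<psi> (\<lambda>k. \<omega> (\<iota> k))) = R"
    and AEdec: "AE \<omega> in M. \<forall>k. \<psi> (\<lambda>k. \<omega> (\<iota> k)) \<in> U k \<longleftrightarrow> \<omega> (\<iota> k)"
    if R: "distr M Cantor (\<lambda>\<omega> k. \<omega> (\<iota> k)) = distr R Cantor (\<lambda>x k. x \<in> U k)" "R \<in> prob_measures"
    and [measurable]: "(\<lambda>\<omega> k. \<omega> (\<iota> k)) \<in> Cantor \<rightarrow>\<^sub>M Cantor"
    for R and \<iota> :: "nat \<Rightarrow> nat"
  proof -
    have R': "sets R = sets borel" using R by (simp add: prob_measures_def)
    note [measurable_cong] = R'
    have "distr M borel (\<lambda>\<omega>. \<psi> (\<lambda>k. \<omega> (\<iota> k))) = distr (distr M Cantor (\<lambda>\<omega> k. \<omega> (\<iota> k))) borel \<psi>"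
      by (subst distr_distr) (auto simp: comp_def)
    also have "\<dots> = distr R borel (\<lambda>x. x)"
      unfolding R by (subst distr_distr) (auto simp: comp_def \<psi>)
    also have "\<dots> = R" using R' by (intro distr_id2) simp
    finally show "distr M borel (\<lambda>\<omega>. \<psi> (\<lambda>k. \<omega> (\<iota> k))) = R" .
    have "AE \<omega> in distr R Cantor (\<lambda>x k. x \<in> U k). \<forall>k. \<psi> \<omega> \<in> U k \<longleftrightarrow> \<omega> k"
      by (subst AE_distr_iff) (auto simp: \<psi>)
    then have "AE \<omega> in distr M Cantor (\<lambda>\<omega> k. \<omega> (\<iota> k)). \<forall>k. \<psi> \<omega> \<in> U k \<longleftrightarrow> \<omega> k"
      unfolding R .
    then show "AE \<omega> in M. \<forall>k. \<psi> (\<lambda>k. \<omega> (\<iota> k)) \<in> U k \<longleftrightarrow> \<omega> (\<iota> k)"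
      by (subst (asm) AE_distr_iff) auto
  qed
  show thesis
  proof (rule that[OF s])
    have "sets (P \<Otimes>\<^sub>M Q) = sets (borel \<Otimes>\<^sub>M borel)"
      by (rule sets_pair_measure_cong) fact+
    moreover have "distr L P fst = P"
    proof -
      have "distr L P fst = distr L borel fst" by (rule distr_cong) (auto simp: \<open>sets P = sets borel\<close>)
      also have "\<dots> = distr M borel (\<lambda>\<omega>. \<psi> (\<lambda>k. \<omega> (2 * k)))"
        unfolding L_def by (subst distr_distr) (auto simp: comp_def z_def)
      also have "\<dots> = P" by (rule dec[OF mP P]) measurable
      finally show ?thesis .
    qed
    moreover have "distr L Q snd = Q"
    proof -
      have "distr L Q snd = distr L borel snd" by (rule distr_cong) (auto simp: \<open>sets Q = sets borel\<close>)
      also have "\<dots> = distr M borel (\<lambda>\<omega>. \<psi> (\<lambda>k. \<omega> (Suc (2 * k))))"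
        unfolding L_def by (subst distr_distr) (auto simp: comp_def z_def)
      also have "\<dots> = Q" by (rule dec[OF mQ Q]) measurable
      finally show ?thesis .
    qed
    ultimately show "L \<in> couplings P Q" by (simp add: couplings_def L_def)
    fix N :: nat and \<Phi> :: "(nat \<Rightarrow> bool) \<Rightarrow> real"
    assume \<Phi>: "\<And>\<omega> \<omega>'. (\<And>k. k < N \<Longrightarrow> \<omega> k = \<omega>' k) \<Longrightarrow> \<Phi> \<omega> = \<Phi> \<omega>'"
    have m\<Phi>[measurable]: "\<Phi> \<in> borel_measurable Cantor"
      using \<Phi> by (rule cylinder_function_measurable)
    have ms[measurable]: "(\<lambda>z k. z \<in> strip U k) \<in> borel \<Otimes>\<^sub>M borel \<rightarrow>\<^sub>M Cantor"
      by (rule measurable_PiM_single') (auto simp: strip_def)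
    have "AE \<omega> in M. \<forall>k. \<psi> (\<lambda>k. \<omega> (2 * k)) \<in> U k \<longleftrightarrow> \<omega> (2 * k)"
      by (rule AEdec[OF mP P]) measurable
    moreover have "AE \<omega> in M. \<forall>k. \<psi> (\<lambda>k. \<omega> (Suc (2 * k))) \<in> U k \<longleftrightarrow> \<omega> (Suc (2 * k))"
      by (rule AEdec[OF mQ Q]) measurable
    \<comment> \<open>No mass escapes to bit sequences that code no pair.\<close>
    ultimately have AE: "AE \<omega> in M. (\<lambda>k. z \<omega> \<in> strip U k) = \<omega>"
    proof (eventually_elim)
      case (elim \<omega>)
      show ?case
      proof
        fix k show "(z \<omega> \<in> strip U k) = \<omega> k"
          using elim[rule_format, of "k div 2"] by (cases "even k") (auto simp: strip_def z_def)
      qed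
    qed
    have "(\<integral>z. \<Phi> (\<lambda>k. z \<in> strip U k) \<partial>L) = (\<integral>\<omega>. \<Phi> (\<lambda>k. z \<omega> \<in> strip U k) \<partial>M)"
      unfolding L_def by (rule integral_distr) (auto intro!: measurable_compose[OF ms m\<Phi>])
    also have "\<dots> = (\<integral>\<omega>. \<Phi> \<omega> \<partial>M)"
    proof (rule integral_cong_AE)
      show "(\<lambda>\<omega>. \<Phi> (\<lambda>k. z \<omega> \<in> strip U k)) \<in> borel_measurable M"
        by (rule measurable_compose[OF _ measurable_compose[OF ms m\<Phi>]]) simp
    qed (use AE in auto)
    finally have "(\<integral>z. \<Phi> (\<lambda>k. z \<in> strip U k) \<partial>L) = (\<integral>\<omega>. \<Phi> \<omega> \<partial>M)" .
    then show "(\<lambda>n. measure_pmf.expectation (\<pi> (s n)) (\<lambda>z. \<Phi> (\<lambda>k. z \<in> strip U k)))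
         \<longlonglongrightarrow> (\<integral>z. \<Phi> (\<lambda>k. z \<in> strip U k) \<partial>L)"
      using conv[of N \<Phi>] \<Phi> by metis
  qed
qed

section \<open>Kantorovich duality\<close>

text \<open>Finite intersections of a countable basis; the empty intersection contributes
  \<open>UNIV\<close>, needed for the event that prescribes no bit.\<close>

lemma ex_Int_stable_countable_basis:
  obtains U :: "nat \<Rightarrow> 'b::second_countable_topology set" where
    "topological_basis (range U)" "\<And>i j. U i \<inter> U j \<in> range U" "UNIV \<in> range U"
proof -
  obtain B :: "'b set set" where B: "countable B" "topological_basis B"
    using ex_countable_basis by blast
  define C where "C = Inter ` {F. F \<subseteq> B \<and> finite F}"
  have cC: "countable C"
    unfolding C_def using countable_Collect_finite_subset[OF B(1)]
    by (intro countable_image) (simp add: conj_commute)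
  have ne: "UNIV \<in> C" unfolding C_def by (rule image_eqI[of _ _ "{}"]) auto
  define U where "U = from_nat_into C"
  have rU: "range U = C" unfolding U_def using cC ne by (intro range_from_nat_into) auto
  have "B \<subseteq> C"
  proof
    fix b assume "b \<in> B"
    then show "b \<in> C" unfolding C_def by (intro image_eqI[of _ _ "{b}"]) auto
  qed
  moreover have "open X" if "X \<in> C" for X
    using that topological_basis_open[OF B(2)] unfolding C_def by (auto intro!: open_Inter)
  ultimately have "topological_basis C"
    using B(2) unfolding topological_basis_def by (meson subset_trans)
  moreover have "X \<inter> Y \<in> C" if "X \<in> C" "Y \<in> C" for X Y
  proof -
    obtain F G where F: "F \<subseteq> B" "finite F" "X = \<Inter> F" and G: "G \<subseteq> B" "finite G" "Y = \<Inter> G"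
      using \<open>X \<in> C\<close> \<open>Y \<in> C\<close> unfolding C_def by auto
    then show ?thesis unfolding C_def by (intro image_eqI[of _ _ "F \<union> G"]) auto
  qed
  ultimately show thesis using that[of U] ne unfolding rU using rU by (metis rangeI)
qed

text \<open>A finite truncation of the cost, as a function of the interleaved code of a pair.\<close>

primrec cylinder_max :: "(nat \<Rightarrow> real) \<Rightarrow> (nat \<Rightarrow> nat) \<Rightarrow> (nat \<Rightarrow> nat) \<Rightarrow> nat \<Rightarrow> (nat \<Rightarrow> bool) \<Rightarrow> real" where
  "cylinder_max t i j 0 \<omega> = 0"
| "cylinder_max t i j (Suc n) \<omega> = max (cylinder_max t i j n \<omega>) (t n * of_bool (\<omega> (2 * i n) \<and> \<omega> (Suc (2 * j n))))"

lemma cylinder_max_nonneg: "0 \<le> cylinder_max t i j n \<omega>"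
  by (induction n) auto

lemma cylinder_max_mono: "m \<le> n \<Longrightarrow> cylinder_max t i j m \<omega> \<le> cylinder_max t i j n \<omega>"
  by (induction rule: dec_induct) auto

lemma cylinder_max_bounded: "\<exists>B. \<forall>\<omega>. cylinder_max t i j n \<omega> \<le> B"
proof (induction n)
  case (Suc n)
  then obtain B where B: "cylinder_max t i j n \<omega> \<le> B" for \<omega> by auto
  have "cylinder_max t i j (Suc n) \<omega> \<le> max B (max 0 (t n))" for \<omega>
    using B[of \<omega>] by auto
  then show ?case by blast
qed auto

lemma cylinder_max_le:
  assumes "0 \<le> C" "\<And>m. m < n \<Longrightarrow> t m * of_bool (\<omega> (2 * i m) \<and> \<omega> (Suc (2 * j m))) \<le> C"
  shows "cylinder_max t i j n \<omega> \<le> C"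
  using assms by (induction n) auto

lemma cylinder_max_finite_dep:
  "\<exists>N. \<forall>\<omega> \<omega>'. (\<forall>k<N. \<omega> k = \<omega>' k) \<longrightarrow> cylinder_max t i j n \<omega> = cylinder_max t i j n \<omega>'"
proof (induction n)
  case (Suc n)
  then obtain N where N: "(\<forall>k<N. \<omega> k = \<omega>' k) \<Longrightarrow> cylinder_max t i j n \<omega> = cylinder_max t i j n \<omega>'" for \<omega> \<omega>'
    by blast
  let ?N = "N + 2 * i n + 2 * j n + 2"
  have "cylinder_max t i j (Suc n) \<omega> = cylinder_max t i j (Suc n) \<omega>'" if "\<forall>k<?N. \<omega> k = \<omega>' k" for \<omega> \<omega>'
  proof -
    have "\<omega> (2 * i n) = \<omega>' (2 * i n)" "\<omega> (Suc (2 * j n)) = \<omega>' (Suc (2 * j n))" using that by auto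
    moreover have "cylinder_max t i j n \<omega> = cylinder_max t i j n \<omega>'" using that by (intro N) auto
    ultimately show ?thesis by simp
  qed
  then show ?case by blast
qed auto

text \<open>Enumerate all triples of a rational level and two basic sets. By lower semicontinuity,
  whenever c exceeds a rational at z it does so on a whole basic box around z, so the step functions
  with c above their level on the box have supremum c.\<close>

lemma lsc_cost_eq_SUP_cylinders:
  fixes c :: "'b::second_countable_topology \<Rightarrow> 'b \<Rightarrow> real" and U :: "nat \<Rightarrow> 'b set"
  assumes basis: "topological_basis (range U)"
    and lsc: "lsc_cost c" and nn: "\<And>x y. 0 \<le> c x y"
  obtains t i j where
    "\<And>n z. cylinder_max t i j n (\<lambda>k. z \<in> strip U k) \<le> c (fst z) (snd z)"
    "\<And>z. (SUP n. ennreal (cylinder_max t i j n (\<lambda>k. z \<in> strip U k))) = ennreal (c (fst z) (snd z))"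
proof -
  define T :: "nat \<Rightarrow> rat \<times> nat \<times> nat" where "T = from_nat"
  define i where "i n = fst (snd (T n))" for n
  define j where "j n = snd (snd (T n))" for n
  \<comment> \<open>Triples whose level is not a lower bound of c on the box get level 0, which lies
    below c because c is nonnegative.\<close>
  define t where "t n = (if \<forall>x\<in>U (i n). \<forall>y\<in>U (j n). of_rat (fst (T n)) \<le> c x y then of_rat (fst (T n)) else 0 :: real)" for n
  let ?m = "\<lambda>n z. cylinder_max t i j n (\<lambda>k. z \<in> strip U k)"
  have le: "?m n z \<le> c (fst z) (snd z)" for n z
    using nn by (intro cylinder_max_le) (auto simp: t_def)
  have "(SUP n. ennreal (?m n z)) = ennreal (c (fst z) (snd z))" for z
  proof (rule antisym)
    show "(SUP n. ennreal (?m n z)) \<le> ennreal (c (fst z) (snd z))"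
      by (intro SUP_least ennreal_leI le)
    have approx: "\<exists>n. q \<le> ?m n z" if q: "q < c (fst z) (snd z)" for q
    proof -
      obtain p where p: "q < of_rat p" "of_rat p < c (fst z) (snd z)"
        using of_rat_dense[OF q] by blast
      have "open (- {z. c (fst z) (snd z) \<le> of_rat p})"
        using lsc unfolding lsc_cost_def by (simp add: open_closed)
      moreover have "(fst z, snd z) \<in> - {z. c (fst z) (snd z) \<le> of_rat p}" using p by simp
      ultimately obtain A B where AB': "open A" "open B" "(fst z, snd z) \<in> A \<times> B"
          and AB: "A \<times> B \<subseteq> - {z. c (fst z) (snd z) \<le> of_rat p}"
        by (rule open_prod_elim)
      then have z: "fst z \<in> A" "snd z \<in> B" by auto
      obtain a where a: "fst z \<in> U a" "U a \<subseteq> A"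
        using topological_basisE[OF basis AB'(1) z(1)] by blast
      obtain b where b: "snd z \<in> U b" "U b \<subseteq> B"
        using topological_basisE[OF basis AB'(2) z(2)] by blast
      define n where "n = to_nat (p, a, b)"
      have T: "fst (T n) = p" "i n = a" "j n = b" by (auto simp: T_def n_def i_def j_def)
      have "\<forall>x\<in>U a. \<forall>y\<in>U b. of_rat p \<le> c x y"
      proof (intro ballI)
        fix x y assume "x \<in> U a" "y \<in> U b"
        then have "(x, y) \<in> - {z. c (fst z) (snd z) \<le> of_rat p}" using a b AB by blast
        then show "of_rat p \<le> c x y" by simp
      qed
      then have "t n = of_rat p" unfolding t_def T by (rule if_P)
      \<comment> \<open>\<open>Suc n\<close>, because the maximum of length n only uses the entries
        below n.\<close>
      then have "of_rat p \<le> ?m (Suc n) z" using a b by (simp add: T)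
      then show ?thesis using p by (intro exI[of _ "Suc n"]) simp
    qed
    show "ennreal (c (fst z) (snd z)) \<le> (SUP n. ennreal (?m n z))"
    proof (rule ennreal_le_epsilon)
      fix e :: real assume "0 < e"
      then obtain n where "c (fst z) (snd z) - e \<le> ?m n z" using approx[of "c (fst z) (snd z) - e"] by auto
      then have "ennreal (c (fst z) (snd z)) \<le> ennreal (?m n z + e)" by (intro ennreal_leI) simp
      also have "\<dots> = ennreal (?m n z) + ennreal e"
        using cylinder_max_nonneg \<open>0 < e\<close> by (intro ennreal_plus) auto
      also have "\<dots> \<le> (SUP n. ennreal (?m n z)) + ennreal e"
        by (intro add_right_mono SUP_upper) simp
      finally show "ennreal (c (fst z) (snd z)) \<le> (SUP n. ennreal (?m n z)) + ennreal e" .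
    qed
  qed
  with le show thesis by (rule that)
qed

text \<open>A dual pair is given by a constant and by the coefficients of the indicators of \<open>strip U k\<close>; rational
  coefficients make the family countable.\<close>

definition dual_fst :: "(nat \<Rightarrow> 'b set) \<Rightarrow> rat \<times> rat list \<Rightarrow> 'b \<Rightarrow> real" where
  "dual_fst U p x = of_rat (fst p) +
     (\<Sum>k<length (snd p). if even k then of_rat (snd p ! k) * of_bool (x \<in> U (k div 2)) else 0)"

definition dual_snd :: "(nat \<Rightarrow> 'b set) \<Rightarrow> rat \<times> rat list \<Rightarrow> 'b \<Rightarrow> real" where
  "dual_snd U p y =
     (\<Sum>k<length (snd p). if even k then 0 else of_rat (snd p ! k) * of_bool (y \<in> U (k div 2)))"

lemma dual_sum_eq:
  "dual_fst U p (fst z) + dual_snd U p (snd z)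
     = of_rat (fst p) + (\<Sum>k<length (snd p). of_rat (snd p ! k) * of_bool (z \<in> strip U k))"
  unfolding dual_fst_def dual_snd_def add.assoc sum.distrib[symmetric]
  by (intro arg_cong2[where f="(+)"] refl sum.cong) (auto simp: strip_def mem_Times_iff)

lemma dual_bounded:
  "\<bar>dual_fst U p x\<bar> \<le> \<bar>of_rat (fst p)\<bar> + (\<Sum>k<length (snd p). \<bar>of_rat (snd p ! k)\<bar>)"
  "\<bar>dual_snd U p x\<bar> \<le> \<bar>of_rat (fst p)\<bar> + (\<Sum>k<length (snd p). \<bar>of_rat (snd p ! k)\<bar>)"
proof -
  show "\<bar>dual_fst U p x\<bar> \<le> \<bar>of_rat (fst p)\<bar> + (\<Sum>k<length (snd p). \<bar>of_rat (snd p ! k)\<bar>)"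
    unfolding dual_fst_def
    by (intro order_trans[OF abs_triangle_ineq] add_mono order_refl order_trans[OF sum_abs] sum_mono) auto
  have "\<bar>dual_snd U p x\<bar> \<le> (\<Sum>k<length (snd p). \<bar>of_rat (snd p ! k)\<bar>)"
    unfolding dual_snd_def by (intro order_trans[OF sum_abs] sum_mono) auto
  then show "\<bar>dual_snd U p x\<bar> \<le> \<bar>of_rat (fst p)\<bar> + (\<Sum>k<length (snd p). \<bar>of_rat (snd p ! k)\<bar>)"
    by (simp add: add_increasing)
qed

lemma dual_measurable:
  assumes "\<And>k. U k \<in> sets borel"
  shows "dual_fst U p \<in> borel_measurable borel" "dual_snd U p \<in> borel_measurable borel"
proof -
  note [measurable] = assms
  show "dual_fst U p \<in> borel_measurable borel" "dual_snd U p \<in> borel_measurable borel"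
    unfolding dual_fst_def dual_snd_def by measurable
qed

lemma integral_dual_sum:
  assumes P: "P \<in> prob_measures" and Q: "Q \<in> prob_measures" and U: "\<And>k. U k \<in> sets borel"
  shows "(\<integral>x. dual_fst U p x \<partial>P) + (\<integral>y. dual_snd U p y \<partial>Q) = of_rat (fst p) +
    (\<Sum>k<length (snd p). of_rat (snd p ! k) * (if even k then measure P (U (k div 2)) else measure Q (U (k div 2))))"
proof -
  interpret P: prob_space P using P by (simp add: prob_measures_def)
  interpret Q: prob_space Q using Q by (simp add: prob_measures_def)
  have sP: "sets P = sets borel" and sQ: "sets Q = sets borel"
    using P Q by (auto simp: prob_measures_def)
  note [measurable_cong] = sP sQ
  note [measurable] = U
  have sp: "space P = UNIV" "space Q = UNIV"
    using sets_eq_imp_space_eq[OF sP] sets_eq_imp_space_eq[OF sQ] by auto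
  have iP: "(\<integral>x. of_bool (x \<in> U k) \<partial>P) = measure P (U k)" and iQ: "(\<integral>x. of_bool (x \<in> U k) \<partial>Q) = measure Q (U k)" for k
    by (simp_all add: indicator_def[symmetric] of_bool_def[symmetric] sp flip: indicator_def)
  have intP: "integrable P (\<lambda>x. of_bool (x \<in> U k) :: real)" for k
    by (rule P.integrable_const_bound[where B=1]) auto
  have intQ: "integrable Q (\<lambda>x. of_bool (x \<in> U k) :: real)" for k
    by (rule Q.integrable_const_bound[where B=1]) auto
  have intP': "integrable P (\<lambda>x. if even k then q * of_bool (x \<in> U l) else 0)"
    and intQ': "integrable Q (\<lambda>x. if even k then 0 else q * of_bool (x \<in> U l))" for k l :: nat and q :: real
    using intP intQ by (cases "even k"; simp)+
  have "(\<integral>x. dual_fst U p x \<partial>P) = of_rat (fst p) + (\<Sum>k<length (snd p). \<integral>x. (if even k then of_rat (snd p ! k) * of_bool (x \<in> U (k div 2)) else 0) \<partial>P)"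
    unfolding dual_fst_def
    by (subst Bochner_Integration.integral_add)
       (auto intro!: Bochner_Integration.integrable_sum intP' Bochner_Integration.integral_sum simp: P.prob_space)
  also have "\<dots> = of_rat (fst p) + (\<Sum>k<length (snd p). if even k then of_rat (snd p ! k) * measure P (U (k div 2)) else 0)"
    by (intro arg_cong2[where f="(+)"] refl sum.cong) (simp add: iP)
  finally have 1: "(\<integral>x. dual_fst U p x \<partial>P) = \<dots>" .
  have "(\<integral>x. dual_snd U p x \<partial>Q) = (\<Sum>k<length (snd p). \<integral>x. (if even k then 0 else of_rat (snd p ! k) * of_bool (x \<in> U (k div 2))) \<partial>Q)"
    unfolding dual_snd_def
    by (intro Bochner_Integration.integral_sum) (rule intQ')
  also have "\<dots> = (\<Sum>k<length (snd p). if even k then 0 else of_rat (snd p ! k) * measure Q (U (k div 2)))"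
    by (intro sum.cong refl) (simp add: iQ)
  finally show ?thesis
    unfolding 1 add.assoc by (simp add: sum.distrib[symmetric]) (intro sum.cong refl, auto)
qed

section \<open>Almost optimal almost-couplings from the dual bound\<close>

text \<open>Rounding is always downwards: the coefficients multiply indicators, so an upper bound on
  the sum of a dual pair survives.\<close>

lemma rational_dual_near:
  fixes a :: "nat \<Rightarrow> real" and e \<eta> :: real
  assumes "0 < \<eta>"
  obtains p :: "rat \<times> rat list" where "length (snd p) = n" 
    "of_rat (fst p) \<le> e" "e - \<eta> \<le> of_rat (fst p)"
    "\<And>k. k < n \<Longrightarrow> of_rat (snd p ! k) \<le> a k" "\<And>k. k < n \<Longrightarrow> a k - \<eta> \<le> of_rat (snd p ! k)"
proof -
  have "\<exists>q. x - \<eta> \<le> of_rat q \<and> of_rat q \<le> x" for x :: real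
    using of_rat_dense[of "x - \<eta>" x] assms by (auto intro: less_imp_le)
  then obtain R where R: "x - \<eta> \<le> of_rat (R x)" "of_rat (R x) \<le> x" for x :: real
    by metis
  show thesis
    by (rule that[of "(R e, map (\<lambda>k. R (a k)) [0..<n])"]) (use R in auto)
qed

text \<open>The first-order inequality at a near-minimiser says that the constant \<open>e\<close>
  together with the strip coefficients \<open>- lam * E k\<close> is a dual pair below d.
  Integrating it against P and Q replaces each strip indicator by \<open>r k\<close>, the penalty
  terms cancel, and the dual value is the penalised objective minus \<delta>/2. The assumed bound v
  on dual values therefore bounds the objective.\<close>

lemma near_optimal_near_coupling:
  fixes d :: "'b::topological_space \<times> 'b \<Rightarrow> real" and U :: "nat \<Rightarrow> 'b set" and n :: nat
  assumes P: "P \<in> prob_measures" and Q: "Q \<in> prob_measures" and U: "\<And>k. U k \<in> sets borel"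
    and d: "\<And>z. 0 \<le> d z" "\<And>z. d z \<le> B"
    and dual: "\<And>p. (\<And>z. dual_fst U p (fst z) + dual_snd U p (snd z) \<le> d z) \<Longrightarrow>
        (\<integral>x. dual_fst U p x \<partial>P) + (\<integral>y. dual_snd U p y \<partial>Q) \<le> v"
    and lam: "0 \<le> lam" and \<delta>: "0 < \<delta>"
  obtains \<pi> where "measure_pmf.expectation \<pi> d + lam * (\<Sum>k<n. (measure_pmf.expectation \<pi> (\<lambda>z. of_bool (z \<in> strip U k))
        - (if even k then measure P (U (k div 2)) else measure Q (U (k div 2))))\<^sup>2) \<le> v + \<delta>"
proof -
  define r where "r k = (if even k then measure P (U (k div 2)) else measure Q (U (k div 2)))" for k
  have r: "0 \<le> r k" "r k \<le> 1" for k
    using P Q by (auto simp: r_def prob_measures_def prob_space.prob_le_1)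
  let ?h = "\<lambda>k z. of_bool (z \<in> strip U k) :: real"
  obtain \<pi> where \<pi>: "\<And>z. measure_pmf.expectation \<pi> d + lam * (\<Sum>k<n. (measure_pmf.expectation \<pi> (?h k) - r k)\<^sup>2) - \<delta>/2
       \<le> d z + lam * (\<Sum>k<n. (measure_pmf.expectation \<pi> (?h k) - r k) * (?h k z - r k))"
    using penalty_near_minimizer[of "{..<n}" d B ?h lam "\<delta>/2" r] d lam \<delta> by (auto simp del: of_bool_eq_iff)
  define E where "E k = measure_pmf.expectation \<pi> (?h k) - r k" for k
  define w where "w = measure_pmf.expectation \<pi> d + lam * (\<Sum>k<n. (E k)\<^sup>2)"
  define e where "e = w - \<delta>/2 + (\<Sum>k<n. lam * E k * r k)"
  \<comment> \<open>Rounding the constant and n coefficients loses at most \<eta> each, as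
    \<open>r k \<le> 1\<close>; the total is the remaining half of \<delta>.\<close>
  define \<eta> where "\<eta> = \<delta> / (2 * (n + 1))"
  have \<eta>: "0 < \<eta>" "(n + 1) * \<eta> = \<delta> / 2"
    using \<delta> by (auto simp: \<eta>_def field_simps)
  obtain p where p: "length (snd p) = n" "of_rat (fst p) \<le> e" "e - \<eta> \<le> of_rat (fst p)"
    "\<And>k. k < n \<Longrightarrow> of_rat (snd p ! k) \<le> - lam * E k" "\<And>k. k < n \<Longrightarrow> - lam * E k - \<eta> \<le> of_rat (snd p ! k)"
    using rational_dual_near[OF \<eta>(1), of n e "\<lambda>k. - lam * E k"] by blast
  have "dual_fst U p (fst z) + dual_snd U p (snd z) \<le> d z" for z
  proof -
    have "dual_fst U p (fst z) + dual_snd U p (snd z) = of_rat (fst p) + (\<Sum>k<n. of_rat (snd p ! k) * ?h k z)"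
      unfolding dual_sum_eq p(1) ..
    also have "\<dots> \<le> e + (\<Sum>k<n. (- lam * E k) * ?h k z)"
      using p by (intro add_mono sum_mono mult_right_mono) auto
    also have "\<dots> = w - \<delta>/2 - lam * (\<Sum>k<n. E k * (?h k z - r k))"
    proof -
      have "(\<Sum>k<n. lam * E k * r k) + (\<Sum>k<n. (- lam * E k) * b k) = - lam * (\<Sum>k<n. E k * (b k - r k))" for b
        by (simp add: sum_distrib_left sum.distrib[symmetric] algebra_simps)
      then show ?thesis unfolding e_def by (simp only: add.assoc)
    qed
    also have "\<dots> \<le> d z"
      using \<pi>[of z] unfolding E_def[symmetric] w_def by linarith
    finally show ?thesis .
  qed
  then have "(\<integral>x. dual_fst U p x \<partial>P) + (\<integral>y. dual_snd U p y \<partial>Q) \<le> v" by (rule dual)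
  then have "of_rat (fst p) + (\<Sum>k<n. of_rat (snd p ! k) * r k) \<le> v"
    unfolding integral_dual_sum[OF P Q U] p(1) r_def .
  moreover have "(e - \<eta>) + (\<Sum>k<n. (- lam * E k - \<eta>) * r k) \<le> of_rat (fst p) + (\<Sum>k<n. of_rat (snd p ! k) * r k)"
    using p r by (intro add_mono sum_mono mult_right_mono) auto
  moreover have "(\<Sum>k<n. (- lam * E k - \<eta>) * r k) = - (\<Sum>k<n. lam * E k * r k) - \<eta> * (\<Sum>k<n. r k)"
    by (simp add: sum_distrib_left sum_subtractf sum_negf algebra_simps)
  moreover have "\<eta> * (\<Sum>k<n. r k) \<le> \<eta> * n"
    using sum_bounded_above[of "{..<n}" r 1] r \<eta> by (intro mult_left_mono) auto
  moreover have "(n + 1) * \<eta> = \<eta> * n + \<eta>" by (simp add: algebra_simps)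
  ultimately have "w \<le> v + \<delta>" using \<eta>(2) unfolding e_def by linarith
  then show thesis using that[of \<pi>] unfolding w_def E_def r_def by blast
qed

lemma borel_measurable_lsc_cost:
  fixes c :: "'b::second_countable_topology \<Rightarrow> 'b \<Rightarrow> real"
  assumes "lsc_cost c"
  shows "(\<lambda>z. c (fst z) (snd z)) \<in> borel_measurable (borel \<Otimes>\<^sub>M borel)"
  unfolding borel_prod
proof (rule borel_measurableI_le)
  fix t
  have "closed {z. c (fst z) (snd z) \<le> t}" using assms by (simp add: lsc_cost_def)
  then show "{z \<in> space borel. c (fst z) (snd z) \<le> t} \<in> sets borel" by simp
qed

lemma couplings_prob_space:
  assumes "prob_space P" "L \<in> couplings P Q"
  shows "prob_space L"
proof -
  have "fst \<in> L \<rightarrow>\<^sub>M P"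
    using assms(2) measurable_cong_sets[of L "P \<Otimes>\<^sub>M Q" P P] by (simp add: couplings_def)
  moreover have "prob_space (distr L P fst)" using assms by (simp add: couplings_def)
  ultimately show ?thesis by (rule prob_space_distrD)
qed

text \<open>The family enumerates all admissible pairs with rational coefficients, so it depends on
  c and the basis but not on P and Q. When the dual supremum is finite, almost-couplings for
  increasing truncations and growing penalties have a limit coupling, whose cost is bounded by
  monotone convergence.\<close>

theorem kantorovich_duality_countable:
  fixes c :: "'b::polish_space \<Rightarrow> 'b \<Rightarrow> real"
  assumes lsc: "lsc_cost c" and nn: "\<And>x y. 0 \<le> c x y"
  obtains f g :: "nat \<Rightarrow> 'b \<Rightarrow> real" and B :: "nat \<Rightarrow> real" where
    "\<And>k. f k \<in> borel_measurable borel" "\<And>k. g k \<in> borel_measurable borel"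
    "\<And>k x. \<bar>f k x\<bar> \<le> B k" "\<And>k x. \<bar>g k x\<bar> \<le> B k"
    "\<And>k x y. f k x + g k y \<le> c x y"
    "\<And>P Q. P \<in> prob_measures \<Longrightarrow> Q \<in> prob_measures \<Longrightarrow>
       W c P Q \<le> (SUP k. ennreal ((\<integral>x. f k x \<partial>P) + (\<integral>y. g k y \<partial>Q)))"
proof -
  obtain U :: "nat \<Rightarrow> 'b set" where basis: "topological_basis (range U)"
    and int: "\<And>i j. U i \<inter> U j \<in> range U" and univ: "UNIV \<in> range U"
    using ex_Int_stable_countable_basis by blast
  have Uo: "U k \<in> sets borel" for k using topological_basis_open[OF basis] by auto
  obtain t i j where cyl_le: "\<And>n z. cylinder_max t i j n (\<lambda>k. z \<in> strip U k) \<le> c (fst z) (snd z)"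
    and cyl_SUP: "\<And>z. (SUP n. ennreal (cylinder_max t i j n (\<lambda>k. z \<in> strip U k))) = ennreal (c (fst z) (snd z))"
    using lsc_cost_eq_SUP_cylinders[OF basis lsc nn] by blast
  define valid where "valid p \<longleftrightarrow> (\<forall>z. dual_fst U p (fst z) + dual_snd U p (snd z) \<le> c (fst z) (snd z))" for p
  \<comment> \<open>Indices of inadmissible pairs are sent to the zero pair, admissible because c is
    nonnegative.\<close>
  define D :: "nat \<Rightarrow> rat \<times> rat list" where "D k = (if valid (from_nat k) then from_nat k else (0, []))" for k
  have "valid (0, [])" using nn by (auto simp: valid_def dual_fst_def dual_snd_def)
  then have validD: "valid (D k)" for k by (auto simp: D_def)
  define B where "B k = \<bar>of_rat (fst (D k))\<bar> + (\<Sum>l<length (snd (D k)). \<bar>of_rat (snd (D k) ! l)\<bar> :: real)" for k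
  show thesis
  proof (rule that[of "\<lambda>k. dual_fst U (D k)" "\<lambda>k. dual_snd U (D k)" B])
    show "dual_fst U (D k) \<in> borel_measurable borel" "dual_snd U (D k) \<in> borel_measurable borel" for k
      using dual_measurable[OF Uo] by auto
    show "\<bar>dual_fst U (D k) x\<bar> \<le> B k" "\<bar>dual_snd U (D k) x\<bar> \<le> B k" for k x
      unfolding B_def by (rule dual_bounded)+
    show "dual_fst U (D k) x + dual_snd U (D k) y \<le> c x y" for k x y
      using validD[of k] unfolding valid_def by (metis fst_conv snd_conv)
    fix P Q :: "'b measure" assume P: "P \<in> prob_measures" and Q: "Q \<in> prob_measures"
    let ?V = "SUP k. ennreal ((\<integral>x. dual_fst U (D k) x \<partial>P) + (\<integral>y. dual_snd U (D k) y \<partial>Q))"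
    show "W c P Q \<le> ?V"
    proof (cases "?V = \<top>")
      case False
      then obtain v where v: "0 \<le> v" "?V = ennreal v" by (cases ?V rule: ennreal_cases) auto
      have dual: "(\<integral>x. dual_fst U p x \<partial>P) + (\<integral>y. dual_snd U p y \<partial>Q) \<le> v" if "valid p" for p
      proof -
        have "D (to_nat p) = p" unfolding D_def from_nat_to_nat using that by (rule if_P)
        moreover have "ennreal ((\<integral>x. dual_fst U (D (to_nat p)) x \<partial>P) + (\<integral>y. dual_snd U (D (to_nat p)) y \<partial>Q)) \<le> ?V"
          by (rule SUP_upper) (rule UNIV_I)
        ultimately have "ennreal ((\<integral>x. dual_fst U p x \<partial>P) + (\<integral>y. dual_snd U p y \<partial>Q)) \<le> ?V"
          by (simp only:)
        then show ?thesis unfolding v(2) by (rule ennreal_le_iff[OF v(1), THEN iffD1])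
      qed
      define d where "d n z = cylinder_max t i j n (\<lambda>k. z \<in> strip U k)" for n z
      define r where "r k = (if even k then measure P (U (k div 2)) else measure Q (U (k div 2)))" for k
      have d0: "0 \<le> d n z" for n z unfolding d_def by (rule cylinder_max_nonneg)
      let ?h = "\<lambda>k z. of_bool (z \<in> strip U k) :: real"
      \<comment> \<open>At stage n the penalty has weight n and covers the first n strips. As the
        cost term is nonnegative, the squared discrepancy on a fixed strip is then at most
        \<open>(v + 1) / n\<close>.\<close>
      have "\<exists>\<pi>. measure_pmf.expectation \<pi> (d n) + real n * (\<Sum>k<n. (measure_pmf.expectation \<pi> (?h k) - r k)\<^sup>2)
          \<le> v + 1 / Suc n" for n
      proof -
        obtain b where b: "\<And>z. d n z \<le> b" unfolding d_def using cylinder_max_bounded[of t i j n] by blast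
        have du: "(\<integral>x. dual_fst U p x \<partial>P) + (\<integral>y. dual_snd U p y \<partial>Q) \<le> v"
          if "\<And>z. dual_fst U p (fst z) + dual_snd U p (snd z) \<le> d n z" for p
        proof (rule dual)
          show "valid p" unfolding valid_def using that cyl_le d_def by (metis order_trans)
        qed
        obtain \<pi> where "measure_pmf.expectation \<pi> (d n) + real n * (\<Sum>k<n. (measure_pmf.expectation \<pi> (?h k)
           - (if even k then measure P (U (k div 2)) else measure Q (U (k div 2))))\<^sup>2) \<le> v + 1 / Suc n"
          by (rule near_optimal_near_coupling[OF P Q Uo d0 b du, where n=n and lam="real n" and \<delta>="1 / Suc n"]) auto
        then show ?thesis unfolding r_def by blast
      qed
      then have "\<forall>n. \<exists>\<pi>. measure_pmf.expectation \<pi> (d n)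
          + real n * (\<Sum>k<n. (measure_pmf.expectation \<pi> (?h k) - r k)\<^sup>2) \<le> v + 1 / Suc n"
        by (rule allI)
      from choice[OF this] obtain \<pi> where \<pi>': "\<forall>n. measure_pmf.expectation (\<pi> n) (d n)
          + real n * (\<Sum>k<n. (measure_pmf.expectation (\<pi> n) (?h k) - r k)\<^sup>2) \<le> v + 1 / Suc n"
        by (rule exE)
      note \<pi> = \<pi>'[rule_format]
      have Ed0: "0 \<le> measure_pmf.expectation (\<pi> n) (d m)" for n m
        using d0 by (intro integral_nonneg_AE) auto
      have lim: "(\<lambda>n. measure_pmf.expectation (\<pi> n) (?h k)) \<longlonglongrightarrow> r k" for k
      proof -
        let ?e = "\<lambda>n. measure_pmf.expectation (\<pi> n) (?h k) - r k"
        have "eventually (\<lambda>n. norm ((?e n)\<^sup>2) \<le> (v + 1) / n) sequentially"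
          using eventually_gt_at_top[of k]
        proof eventually_elim
          case (elim n)
          have "real n * (?e n)\<^sup>2 \<le> real n * (\<Sum>k<n. (measure_pmf.expectation (\<pi> n) (?h k) - r k)\<^sup>2)"
            using elim by (intro mult_left_mono member_le_sum[of k "{..<n}" "\<lambda>k. (measure_pmf.expectation (\<pi> n) (?h k) - r k)\<^sup>2"]) auto
          also have "\<dots> \<le> v + 1 / Suc n" using \<pi>[of n] Ed0[of n n] by linarith
          also have "\<dots> \<le> v + 1" by simp
          finally show ?case using elim by (simp add: field_simps)
        qed
        then have "(\<lambda>n. (?e n)\<^sup>2) \<longlonglongrightarrow> 0"
          by (rule Lim_null_comparison) (rule lim_const_over_n)
        then have "(\<lambda>n. sqrt ((?e n)\<^sup>2)) \<longlonglongrightarrow> sqrt 0" by (rule tendsto_real_sqrt)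
        then have "?e \<longlonglongrightarrow> 0" by (simp add: tendsto_rabs_zero_iff)
        then show ?thesis by (rule LIM_zero_cancel)
      qed
      have limP: "(\<lambda>n. measure_pmf.expectation (\<pi> n) (\<lambda>z. of_bool (fst z \<in> U k))) \<longlonglongrightarrow> measure P (U k)" for k
        using lim[of "2 * k"] by (simp add: r_def)
      have limQ: "(\<lambda>n. measure_pmf.expectation (\<pi> n) (\<lambda>z. of_bool (snd z \<in> U k))) \<longlonglongrightarrow> measure Q (U k)" for k
        using lim[of "Suc (2 * k)"] by (simp add: r_def)
      obtain s L where s: "strict_mono s" and L: "L \<in> couplings P Q"
        and conv: "\<And>(N::nat) (\<Phi> :: (nat \<Rightarrow> bool) \<Rightarrow> real).
       (\<And>\<omega> \<omega>'. (\<And>k. k < N \<Longrightarrow> \<omega> k = \<omega>' k) \<Longrightarrow> \<Phi> \<omega> = \<Phi> \<omega>') \<Longrightarrow>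
       (\<lambda>n. measure_pmf.expectation (\<pi> (s n)) (\<lambda>z. \<Phi> (\<lambda>k. z \<in> strip U k)))
         \<longlonglongrightarrow> (\<integral>z. \<Phi> (\<lambda>k. z \<in> strip U k) \<partial>L)"
        by (rule couplings_limit[OF basis int univ P Q limP limQ]) blast
      interpret L: prob_space L
        using P L by (intro couplings_prob_space[of P L Q]) (auto simp: prob_measures_def)
      have sL: "sets L = sets (borel \<Otimes>\<^sub>M borel)"
        using L P Q sets_pair_measure_cong[of P borel Q borel] by (simp add: couplings_def prob_measures_def)
      note [measurable_cong] = sL
      have sge: "n \<le> s n" for n using s by (rule strict_mono_imp_increasing)
      have dm: "d m \<in> borel_measurable L" for m
      proof -
        have "(\<lambda>z k. z \<in> strip U k) \<in> borel \<Otimes>\<^sub>M borel \<rightarrow>\<^sub>M Cantor"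
          by (rule measurable_PiM_single') (use Uo in \<open>auto simp: strip_def\<close>)
        moreover obtain N where "\<And>\<omega> \<omega>'. (\<And>k. k < N \<Longrightarrow> \<omega> k = \<omega>' k) \<Longrightarrow> cylinder_max t i j m \<omega> = cylinder_max t i j m \<omega>'"
          using cylinder_max_finite_dep by metis
        then have "cylinder_max t i j m \<in> borel_measurable Cantor"
          by (rule cylinder_function_measurable)
        ultimately have "(\<lambda>z. cylinder_max t i j m (\<lambda>k. z \<in> strip U k)) \<in> borel_measurable (borel \<Otimes>\<^sub>M borel)"
          by (rule measurable_compose)
        then show ?thesis unfolding d_def using measurable_cong_sets[OF sL refl] by blast
      qed
      \<comment> \<open>The truncation m stays fixed while the subsequence runs: for
        \<open>n \<ge> m\<close> the cost used at stage \<open>s n\<close> dominates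
        \<open>d m\<close>, and \<open>d m\<close> depends on finitely many bits.\<close>
      have dL: "(\<integral>z. d m z \<partial>L) \<le> v" for m
      proof (rule LIMSEQ_le)
        obtain N where "\<And>\<omega> \<omega>'. (\<And>k. k < N \<Longrightarrow> \<omega> k = \<omega>' k) \<Longrightarrow> cylinder_max t i j m \<omega> = cylinder_max t i j m \<omega>'"
          using cylinder_max_finite_dep by metis
        then show "(\<lambda>n. measure_pmf.expectation (\<pi> (s n)) (d m)) \<longlonglongrightarrow> (\<integral>z. d m z \<partial>L)"
          unfolding d_def by (rule conv)
        have "(\<lambda>n. v + 1 / Suc n) \<longlonglongrightarrow> v + 0"
          by (intro tendsto_add tendsto_const LIMSEQ_Suc[OF lim_1_over_n])
        then show "(\<lambda>n. v + 1 / Suc (s n)) \<longlonglongrightarrow> v"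
          using LIMSEQ_subseq_LIMSEQ[OF _ s, of "\<lambda>n. v + 1 / Suc n" v] by (simp add: comp_def)
        have "measure_pmf.expectation (\<pi> (s n)) (d m) \<le> v + 1 / Suc (s n)" if "m \<le> n" for n
        proof -
          obtain b where b: "\<And>z. d (s n) z \<le> b" unfolding d_def using cylinder_max_bounded[of t i j "s n"] by blast
          have mono: "d m z \<le> d (s n) z" for z
            unfolding d_def using that sge[of n] by (intro cylinder_max_mono) simp
          have "measure_pmf.expectation (\<pi> (s n)) (d m) \<le> measure_pmf.expectation (\<pi> (s n)) (d (s n))"
          proof (rule integral_mono)
            show "integrable (measure_pmf (\<pi> (s n))) (d m)" "integrable (measure_pmf (\<pi> (s n))) (d (s n))"
              using b mono d0 order_trans[OF mono b]
              by (auto intro!: measure_pmf.integrable_const_bound[where B=b])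
          qed (rule mono)
          also have "\<dots> \<le> v + 1 / Suc (s n)"
          proof -
            have "0 \<le> real (s n) * (\<Sum>k<s n. (measure_pmf.expectation (\<pi> (s n)) (?h k) - r k)\<^sup>2)"
              by (intro mult_nonneg_nonneg sum_nonneg) auto
            then show ?thesis using \<pi>[of "s n"] by linarith
          qed
          finally show ?thesis .
        qed
        then show "\<exists>N. \<forall>n\<ge>N. measure_pmf.expectation (\<pi> (s n)) (d m) \<le> v + 1 / Suc (s n)" by blast
      qed
      have "W c P Q \<le> (\<integral>\<^sup>+z. ennreal (c (fst z) (snd z)) \<partial>L)"
        unfolding W_def using L by (rule INF_lower)
      also have "\<dots> = (\<integral>\<^sup>+z. (SUP m. ennreal (d m z)) \<partial>L)"
        unfolding d_def cyl_SUP ..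
      also have "\<dots> = (SUP m. \<integral>\<^sup>+z. ennreal (d m z) \<partial>L)"
      proof (rule nn_integral_monotone_convergence_SUP)
        show "incseq (\<lambda>m z. ennreal (d m z))"
          unfolding d_def by (auto simp: incseq_def le_fun_def intro!: ennreal_leI cylinder_max_mono)
      qed (use dm in measurable)
      also have "\<dots> \<le> ennreal v"
      proof (rule SUP_least)
        fix m
        obtain b where b: "\<And>z. d m z \<le> b" unfolding d_def using cylinder_max_bounded[of t i j m] by blast
        have "integrable L (d m)"
          using b d0 dm by (intro L.integrable_const_bound[where B=b]) auto
        then have "(\<integral>\<^sup>+z. ennreal (d m z) \<partial>L) = ennreal (\<integral>z. d m z \<partial>L)"
          using d0 by (intro nn_integral_eq_integral) auto
        also have "\<dots> \<le> ennreal v" using dL by (rule ennreal_leI)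
        finally show "(\<integral>\<^sup>+z. ennreal (d m z) \<partial>L) \<le> ennreal v" .
      qed
      finally show ?thesis unfolding v(2) .
    next
      case True
      then show ?thesis by (simp only: top_greatest)
    qed
  qed
qed

section \<open>Product measures and mixtures\<close>

text \<open>\<open>ennreal\<close> sends negative reals to 0, so this is Jensen's inequality for the
  positive part; it is needed because dual values may be negative.\<close>

lemma ennreal_integral_le_nn_integral:
  fixes h :: "'b \<Rightarrow> real"
  assumes "integrable M h"
  shows "ennreal (\<integral>x. h x \<partial>M) \<le> (\<integral>\<^sup>+x. ennreal (h x) \<partial>M)"
proof -
  have i: "integrable M (\<lambda>x. max 0 (h x))" using assms by (intro Bochner_Integration.integrable_max) auto
  have "ennreal (\<integral>x. h x \<partial>M) \<le> ennreal (\<integral>x. max 0 (h x) \<partial>M)"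
    using assms i by (intro ennreal_leI integral_mono) auto
  also have "\<dots> = (\<integral>\<^sup>+x. ennreal (max 0 (h x)) \<partial>M)"
    using i by (intro nn_integral_eq_integral[symmetric]) auto
  also have "\<dots> = (\<integral>\<^sup>+x. ennreal (h x) \<partial>M)"
    by (intro nn_integral_cong) (simp add: max_def ennreal_neg)
  finally show ?thesis .
qed

lemma prob_measuresD:
  assumes "P \<in> prob_measures"
  shows "prob_space P" "sets P = sets borel" "space P = UNIV"
  using assms sets_eq_imp_space_eq[of P borel] by (auto simp: prob_measures_def)

lemma prob_measures_eq_space_prob_algebra: "prob_measures = space (prob_algebra borel)"
  by (auto simp: prob_measures_def space_prob_algebra)

lemma sets_powM:
  assumes "sets P = sets (borel :: 'a::topological_space measure)"
  shows "sets (powM P M) = sets (PiM {..<M} (\<lambda>_. borel :: 'a measure))"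
  unfolding powM_def by (rule sets_PiM_cong) (auto simp: assms)

lemma prob_space_powM: "prob_space P \<Longrightarrow> prob_space (powM P M)"
  unfolding powM_def by (rule prob_space_PiM)

text \<open>On a rectangle the product measure is a finite product of evaluations of P, and
  rectangles form an intersection-stable generator.\<close>

lemma measurable_powM:
  "(\<lambda>P. powM P M) \<in> prob_algebra borel \<rightarrow>\<^sub>M prob_algebra (PiM {..<M} (\<lambda>_. borel :: 'a::topological_space measure))"
proof (rule measurable_prob_algebra_generated)
  let ?G = "{Pi\<^sub>E {..<M} E | E. \<forall>i\<in>{..<M}. E i \<in> sets (borel :: 'a measure)}"
  let ?\<Omega> = "(\<Pi>\<^sub>E i\<in>{..<M}. space (borel :: 'a measure))"
  show "sets (PiM {..<M} (\<lambda>_. borel :: 'a measure)) = sigma_sets ?\<Omega> ?G"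
    by (subst sets_PiM, subst prod_algebra_eq_finite) (simp_all add: Pi_iff)
  show "Int_stable ?G" by (rule Int_stable_PiE)
  show "?G \<subseteq> Pow ?\<Omega>" by (auto simp: PiE_iff)
  fix P :: "'a measure" assume "P \<in> space (prob_algebra borel)"
  then have P: "prob_space P" "sets P = sets borel" by (auto simp: space_prob_algebra)
  show "prob_space (powM P M)" using P by (simp add: prob_space_powM)
  show "sets (powM P M) = sets (PiM {..<M} (\<lambda>_. borel))" using P by (simp add: sets_powM)
next
  fix A assume "A \<in> {Pi\<^sub>E {..<M} E | E. \<forall>i\<in>{..<M}. E i \<in> sets (borel :: 'a measure)}"
  then obtain E where E: "A = Pi\<^sub>E {..<M} E" "\<forall>i\<in>{..<M}. E i \<in> sets (borel :: 'a measure)" by auto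
  have "emeasure (powM P M) A = (\<Prod>i<M. emeasure P (E i))" if "P \<in> space (prob_algebra borel)" for P
  proof -
    have pP: "prob_space P" and sP: "sets P = sets borel" using that by (auto simp: space_prob_algebra)
    interpret product_prob_space "\<lambda>_. P" by (rule product_prob_spaceI) (rule pP)
    show ?thesis unfolding powM_def E(1) by (rule emeasure_PiM) (use E(2) in \<open>simp_all add: sP\<close>)
  qed
  moreover have "(\<lambda>P. \<Prod>i<M. emeasure P (E i)) \<in> borel_measurable (prob_algebra borel)"
    using E(2) unfolding prob_algebra_def
    by (intro borel_measurable_prod_ennreal measurable_restrict_space1 measurable_emeasure_subprob_algebra) auto
  ultimately show "(\<lambda>P. emeasure (powM P M) A) \<in> borel_measurable (prob_algebra borel)"
    by (subst measurable_cong) auto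
qed

text \<open>\<open>measure_of\<close> yields the intended values only if the given set function is a
  measure. Identifying it with a monadic bind settles this and provides the Fubini-type formulas for
  the mixture.\<close>

lemma mixture_eq_bind:
  fixes \<nu> :: "'a::topological_space measure measure"
  assumes \<nu>: "prob_space \<nu>" "sets \<nu> = sets (prob_algebra borel)"
  shows "mixture \<nu> M = bind \<nu> (\<lambda>P. powM P M)"
proof -
  have \<nu>': "\<nu> \<in> space (prob_algebra (prob_algebra borel))" using \<nu> by (simp add: space_prob_algebra)
  let ?S = "PiM {..<M} (\<lambda>_. borel :: 'a measure)"
  let ?B = "bind \<nu> (\<lambda>P. powM P M)"
  have sB: "sets ?B = sets ?S" by (rule sets_bind'[OF \<nu>' measurable_powM])
  have spB: "space ?B = space ?S" by (rule sets_eq_imp_space_eq[OF sB])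
  have "?B = measure_of (space ?B) (sets ?B) (emeasure ?B)" by (rule measure_of_of_measure[symmetric])
  also have "\<dots> = measure_of (space ?S) (sets ?S) (\<lambda>A. \<integral>\<^sup>+P. emeasure (powM P M) A \<partial>\<nu>)"
    unfolding sB spB
  proof (rule measure_of_eq)
    show "sets ?S \<subseteq> Pow (space ?S)" by (rule sets.space_closed)
    fix a assume "a \<in> sigma_sets (space ?S) (sets ?S)"
    then have "a \<in> sets ?S" by (simp add: sets.sigma_sets_eq)
    then show "emeasure ?B a = (\<integral>\<^sup>+P. emeasure (powM P M) a \<partial>\<nu>)"
      by (rule emeasure_bind_prob_algebra[OF \<nu>' measurable_powM])
  qed
  finally show ?thesis unfolding mixture_def powM_def ..
qed

text \<open>A sum exceeds t exactly when, for some q, the first part exceeds q and the last term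
  exceeds t - q; hence strict superlevel sets remain open.\<close>

lemma lsc_cost_costM:
  fixes c :: "'a::topological_space \<Rightarrow> 'a \<Rightarrow> real"
  assumes "lsc_cost c"
  shows "lsc_cost (costM c M)"
proof -
  have "open {z. t < (\<Sum>i<M. c (fst z i) (snd z i))}" for t
  proof (induction M arbitrary: t)
    case (Suc M)
    have "{z. t < (\<Sum>i<Suc M. c (fst z i) (snd z i))} =
       (\<Union>q. {z. q < (\<Sum>i<M. c (fst z i) (snd z i))} \<inter> {z. t - q < c (fst z M) (snd z M)})"
    proof (intro set_eqI iffI)
      fix z :: "(nat \<Rightarrow> 'a) \<times> (nat \<Rightarrow> 'a)"
      let ?a = "\<Sum>i<M. c (fst z i) (snd z i)" and ?b = "c (fst z M) (snd z M)"
      assume "z \<in> {z. t < (\<Sum>i<Suc M. c (fst z i) (snd z i))}"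
      then have "t < ?a + ?b" by simp
      \<comment> \<open>The witness q lies below \<open>?a\<close> by half of the surplus over t,
        leaving the other half to \<open>?b\<close>.\<close>
      then have "?a - (?a + ?b - t) / 2 < ?a" "t - (?a - (?a + ?b - t) / 2) < ?b" by (auto simp: field_simps)
      then show "z \<in> (\<Union>q. {z. q < (\<Sum>i<M. c (fst z i) (snd z i))} \<inter> {z. t - q < c (fst z M) (snd z M)})"
        by blast
    qed auto
    moreover have "open {z :: (nat \<Rightarrow> 'a) \<times> (nat \<Rightarrow> 'a). s < c (fst z M) (snd z M)}" for s
    proof -
      have "open {z :: 'a \<times> 'a. s < c (fst z) (snd z)}"
      proof -
        have "{z. s < c (fst z) (snd z)} = - {z. c (fst z) (snd z) \<le> s}" by auto
        then show ?thesis using assms by (simp add: lsc_cost_def open_closed)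
      qed
      moreover have "continuous_on UNIV (\<lambda>z :: (nat \<Rightarrow> 'a) \<times> (nat \<Rightarrow> 'a). (fst z M, snd z M))"
        by (intro continuous_on_Pair; rule continuous_on_product_then_coordinatewise) (intro continuous_intros)+
      ultimately have "open ((\<lambda>z :: (nat \<Rightarrow> 'a) \<times> (nat \<Rightarrow> 'a). (fst z M, snd z M)) -` {z. s < c (fst z) (snd z)})"
        by (rule open_vimage)
      then show ?thesis by (simp add: vimage_def)
    qed
    ultimately show ?case using Suc.IH by (auto intro!: open_UN open_Int)
  qed auto
  then show ?thesis
    unfolding lsc_cost_def costM_def closed_def by (simp add: Compl_eq not_le)
qed

text \<open>The centred terms are bounded by 2B and orthogonal by independence, so the second moment
  of their sum is at most M (2B)^2. The elementary bound w \<le> 1 + w^2 turns this into a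
  first-moment estimate.\<close>

lemma nn_integral_average_deviation:
  fixes g :: "'a \<Rightarrow> real"
  assumes Q: "prob_space Q" and g: "g \<in> borel_measurable Q" "\<And>x. \<bar>g x\<bar> \<le> B" and M: "0 < M"
  shows "(\<integral>\<^sup>+y. ennreal \<bar>(\<Sum>i<M. g (y i)) / M - (\<integral>x. g x \<partial>Q)\<bar> \<partial>powM Q M) \<le> ennreal ((1 + (2 * B)\<^sup>2) / sqrt M)"
proof -
  interpret Q: prob_space Q by fact
  interpret PQ: product_prob_space "\<lambda>_. Q" by (rule product_prob_spaceI) (rule Q)
  interpret QM: prob_space "powM Q M" by (rule prob_space_powM[OF Q])
  note [measurable] = g(1)
  have gi: "integrable Q g" using g by (intro Q.integrable_const_bound[where B=B]) auto
  define h where "h x = g x - (\<integral>x. g x \<partial>Q)" for x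
  have hm[measurable]: "h \<in> borel_measurable Q" unfolding h_def by measurable
  have "\<bar>\<integral>x. g x \<partial>Q\<bar> \<le> B"
    using g gi by (intro order_trans[OF integral_abs_bound] Q.integral_le_const) auto
  then have hb: "\<bar>h x\<bar> \<le> 2 * B" for x using g(2)[of x] unfolding h_def by linarith
  have h0: "(\<integral>x. h x \<partial>Q) = 0" unfolding h_def using gi by (simp add: Q.prob_space)
  have B0: "0 \<le> B" using g(2)[of undefined] by linarith
  have comp[measurable]: "(\<lambda>y. y i) \<in> powM Q M \<rightarrow>\<^sub>M Q" if "i < M" for i
    using that unfolding powM_def by (intro measurable_component_singleton) simp
  have hc: "(\<lambda>y. h (y i)) \<in> borel_measurable (powM Q M)" if "i < M" for i
    by (rule measurable_compose[OF comp[OF that] hm])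
  have hij: "\<bar>h (y i) * h (y j)\<bar> \<le> (2 * B) * (2 * B)" for i j and y :: "nat \<Rightarrow> 'a"
    unfolding abs_mult using hb B0 by (intro mult_mono) auto
  have int: "integrable (powM Q M) (\<lambda>y. h (y i) * h (y j))" if "i < M" "j < M" for i j
    using hij hc[OF that(1)] hc[OF that(2)] by (intro QM.integrable_const_bound[where B="2*B*(2*B)"]) auto
  have off: "(\<integral>y. h (y i) * h (y j) \<partial>powM Q M) = 0" if ij: "i < M" "j < M" "i \<noteq> j" for i j
  proof -
    \<comment> \<open>Factors equal to 1 away from i and j write \<open>h (y i) * h (y j)\<close> as
      a product over all coordinates, so that the integral factorises.\<close>
    let ?f = "\<lambda>k x. (if k = i then h x else 1) * (if k = j then h x else 1)"
    have "(\<integral>y. (\<Prod>k<M. ?f k (y k)) \<partial>PiM {..<M} (\<lambda>_. Q)) = (\<Prod>k<M. integral\<^sup>L Q (?f k))"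
    proof (rule PQ.product_integral_prod)
      fix k
      have "\<bar>?f k x\<bar> \<le> max 1 (2*B)" for x using ij(3) hb[of x] by (auto simp: le_max_iff_disj)
      then show "integrable Q (?f k)" by (intro Q.integrable_const_bound[where B="max 1 (2*B)"]) auto
    qed simp
    moreover have "(\<Prod>k<M. integral\<^sup>L Q (?f k)) = 0"
      using ij h0 by (intro prod_zero) (auto intro!: bexI[of _ i])
    moreover have "(\<Prod>k<M. ?f k (y k)) = h (y i) * h (y j)" for y
      unfolding prod.distrib using ij by (simp add: prod.delta)
    ultimately show ?thesis by (simp add: powM_def)
  qed
  have diag: "(\<integral>y. h (y i) * h (y j) \<partial>powM Q M) \<le> (2 * B)\<^sup>2 * of_bool (i = j)" if ij: "i < M" "j < M" for i j
  proof (cases "i = j")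
    case True
    have "(\<integral>y. h (y i) * h (y j) \<partial>powM Q M) \<le> 2*B*(2*B)"
      by (intro QM.integral_le_const AE_I2 order_trans[OF abs_ge_self hij] int ij)
    then show ?thesis using True by (simp add: power2_eq_square)
  qed (use off[OF ij] in simp)
  define Z where "Z y = (\<Sum>i<M. h (y i))" for y :: "nat \<Rightarrow> 'a"
  have Z2: "(Z y)\<^sup>2 = (\<Sum>i<M. \<Sum>j<M. h (y i) * h (y j))" for y
    unfolding Z_def power2_eq_square sum_product ..
  have iZ2: "integrable (powM Q M) (\<lambda>y. (Z y)\<^sup>2)"
    unfolding Z2 by (intro Bochner_Integration.integrable_sum int) auto
  have "(\<integral>y. (Z y)\<^sup>2 \<partial>powM Q M) = (\<Sum>i<M. \<Sum>j<M. \<integral>y. h (y i) * h (y j) \<partial>powM Q M)"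
    unfolding Z2 by (subst Bochner_Integration.integral_sum, force intro!: Bochner_Integration.integrable_sum int)
      (intro sum.cong refl Bochner_Integration.integral_sum int, auto)
  also have "\<dots> \<le> (\<Sum>i<M. \<Sum>j<M. (2 * B)\<^sup>2 * of_bool (i = j))"
    by (intro sum_mono diag) auto
  also have "\<dots> = M * (2 * B)\<^sup>2"
    by (simp add: sum_distrib_left[symmetric] of_bool_def)
  finally have EZ2: "(\<integral>y. (Z y)\<^sup>2 \<partial>powM Q M) \<le> M * (2 * B)\<^sup>2" .
  have sM: "0 < sqrt M" "sqrt M * sqrt M = M" using M by auto
  have pt: "\<bar>(\<Sum>i<M. g (y i)) / M - (\<integral>x. g x \<partial>Q)\<bar> \<le> (1 + (Z y)\<^sup>2 / M) / sqrt M" for y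
  proof -
    have "(\<Sum>i<M. g (y i)) / M - (\<integral>x. g x \<partial>Q) = Z y / M"
      using M by (simp add: Z_def h_def sum_subtractf field_simps)
    moreover have "\<bar>Z y / M\<bar> \<le> (1 + (Z y)\<^sup>2 / M) / sqrt M"
    proof -
      define w where "w = \<bar>Z y\<bar> / sqrt M"
      have "w \<le> 1 + w\<^sup>2"
      proof (cases "w \<le> 1")
        case False
        then have "w * 1 \<le> w * w" by (intro mult_left_mono) auto
        then show ?thesis by (simp add: power2_eq_square)
      qed (simp add: add_increasing2)
      then have "w / sqrt M \<le> (1 + w\<^sup>2) / sqrt M" using sM by (intro divide_right_mono) auto
      moreover have "w / sqrt M = \<bar>Z y / M\<bar>" using sM by (simp add: w_def)
      moreover have "w\<^sup>2 = (Z y)\<^sup>2 / M" by (simp add: w_def power_divide)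
      ultimately show ?thesis by simp
    qed
    ultimately show ?thesis by simp
  qed
  have "(\<integral>\<^sup>+y. ennreal \<bar>(\<Sum>i<M. g (y i)) / M - (\<integral>x. g x \<partial>Q)\<bar> \<partial>powM Q M)
     \<le> (\<integral>\<^sup>+y. ennreal ((1 + (Z y)\<^sup>2 / M) / sqrt M) \<partial>powM Q M)"
    using pt by (intro nn_integral_mono ennreal_leI) auto
  also have "\<dots> = ennreal (\<integral>y. (1 + (Z y)\<^sup>2 / M) / sqrt M \<partial>powM Q M)"
    using iZ2 sM by (intro nn_integral_eq_integral) (auto intro!: divide_nonneg_nonneg add_nonneg_nonneg)
  also have "(\<integral>y. (1 + (Z y)\<^sup>2 / M) / sqrt M \<partial>powM Q M) = (1 + (\<integral>y. (Z y)\<^sup>2 \<partial>powM Q M) / M) / sqrt M"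
    using iZ2 by (simp add: QM.prob_space)
  also have "\<dots> \<le> (1 + (2 * B)\<^sup>2) / sqrt M"
    using EZ2 sM M by (intro divide_right_mono add_left_mono) (auto simp: pos_divide_le_eq mult.commute)
  finally show ?thesis by (simp add: ennreal_leI)
qed

lemma integral_mixture:
  fixes \<nu> :: "'a::topological_space measure measure" and f :: "_ \<Rightarrow> real"
  assumes \<nu>: "prob_space \<nu>" "sets \<nu> = sets (prob_algebra borel)"
    and f: "f \<in> borel_measurable (PiM {..<M} (\<lambda>_. borel))" "\<And>x. \<bar>f x\<bar> \<le> B"
  shows "(\<integral>x. f x \<partial>mixture \<nu> M) = (\<integral>P. (\<integral>x. f x \<partial>powM P M) \<partial>\<nu>)"
    and "integrable \<nu> (\<lambda>P. \<integral>x. f x \<partial>powM P M)"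
proof -
  interpret prob_space \<nu> by fact
  note [measurable_cong] = \<nu>(2)
  have m: "(\<lambda>P. powM P M) \<in> \<nu> \<rightarrow>\<^sub>M subprob_algebra (PiM {..<M} (\<lambda>_. borel))"
    using measurable_prob_algebraD[OF measurable_powM] measurable_cong_sets[OF \<nu>(2) refl] by blast
  have AE1: "AE P in \<nu>. emeasure (powM P M) (space (powM P M)) \<le> ennreal 1"
    using sets_eq_imp_space_eq[OF \<nu>(2)]
    by (intro AE_I2) (auto simp: space_prob_algebra intro!: subprob_space.emeasure_space_le_1 prob_space_imp_subprob_space prob_space_powM)
  show "(\<integral>x. f x \<partial>mixture \<nu> M) = (\<integral>P. (\<integral>x. f x \<partial>powM P M) \<partial>\<nu>)"
    unfolding mixture_eq_bind[OF \<nu>]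
    by (rule integral_bind[OF f(1) _ m finite_measure_axioms AE1]) (rule f(2))
  have "\<bar>\<integral>x. f x \<partial>powM P M\<bar> \<le> B" if P: "P \<in> space \<nu>" for P
  proof -
    have "prob_space P" "sets P = sets borel"
      using P sets_eq_imp_space_eq[OF \<nu>(2)] by (auto simp: space_prob_algebra)
    then interpret PM: prob_space "powM P M" by (intro prob_space_powM)
    have "integrable (powM P M) f"
      using f(2) measurable_cong_sets[OF sets_powM[OF \<open>sets P = sets borel\<close>, of M] refl] f(1)
      by (intro PM.integrable_const_bound[where B=B]) auto
    then show ?thesis
      using f(2) by (intro order_trans[OF integral_abs_bound] PM.integral_le_const) auto
  qed
  moreover have "(\<lambda>P. \<integral>x. f x \<partial>powM P M) \<in> borel_measurable \<nu>"
    by (rule measurable_compose[OF m integral_measurable_subprob_algebra[OF f(1)]])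
  ultimately show "integrable \<nu> (\<lambda>P. \<integral>x. f x \<partial>powM P M)"
    by (intro integrable_const_bound[where B=B]) auto
qed

lemma nn_integral_mixture:
  fixes \<nu> :: "'a::topological_space measure measure"
  assumes \<nu>: "prob_space \<nu>" "sets \<nu> = sets (prob_algebra borel)"
    and f: "f \<in> borel_measurable (PiM {..<M} (\<lambda>_. borel))"
  shows "(\<integral>\<^sup>+x. f x \<partial>mixture \<nu> M) = (\<integral>\<^sup>+P. (\<integral>\<^sup>+x. f x \<partial>powM P M) \<partial>\<nu>)"
proof -
  have m: "(\<lambda>P. powM P M) \<in> \<nu> \<rightarrow>\<^sub>M subprob_algebra (PiM {..<M} (\<lambda>_. borel))"
    using measurable_prob_algebraD[OF measurable_powM] measurable_cong_sets[OF \<nu>(2) refl] by blast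
  show ?thesis unfolding mixture_eq_bind[OF \<nu>] by (rule nn_integral_bind[OF f m])
qed

lemma mixture_properties:
  fixes \<nu> :: "'a::topological_space measure measure"
  assumes \<nu>: "prob_space \<nu>" "sets \<nu> = sets (prob_algebra borel)"
  shows "prob_space (mixture \<nu> M)" "sets (mixture \<nu> M) = sets (PiM {..<M} (\<lambda>_. borel :: 'a measure))"
proof -
  have \<nu>': "\<nu> \<in> space (prob_algebra (prob_algebra borel))" using \<nu> by (simp add: space_prob_algebra)
  show "prob_space (mixture \<nu> M)" "sets (mixture \<nu> M) = sets (PiM {..<M} (\<lambda>_. borel :: 'a measure))"
    unfolding mixture_eq_bind[OF \<nu>]
    using prob_space_bind'[OF \<nu>' measurable_powM] sets_bind'[OF \<nu>' measurable_powM] by auto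
qed

text \<open>Points of the finite product are functions that are \<open>undefined\<close> from \<open>M\<close> on, so the product embeds
  into the Polish space of all sequences, where the duality applies.\<close>

lemma measurable_id_PiM_borel:
  "(\<lambda>x. x) \<in> PiM {..<M} (\<lambda>_. borel) \<rightarrow>\<^sub>M (borel :: (nat \<Rightarrow> 'a::second_countable_topology) measure)"
proof -
  have "(\<lambda>x. x) \<in> PiM {..<M} (\<lambda>_. borel) \<rightarrow>\<^sub>M PiM UNIV (\<lambda>_. borel :: 'a measure)"
  proof (rule measurable_PiM_single')
    fix i :: nat
    show "(\<lambda>x. x i) \<in> PiM {..<M} (\<lambda>_. borel) \<rightarrow>\<^sub>M (borel :: 'a measure)"
    proof (cases "i < M")
      case False
      then have "x i = undefined" if "x \<in> space (PiM {..<M} (\<lambda>_. borel :: 'a measure))" for x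
        using that by (auto simp: space_PiM PiE_def extensional_def)
      then show ?thesis by (subst measurable_cong[of _ _ "\<lambda>_. undefined"]) auto
    qed simp
  qed auto
  then show ?thesis using measurable_cong_sets[OF refl sets_PiM_equal_borel] by blast
qed

lemma measurable_restrict_borel_PiM:
  "(\<lambda>x. restrict x {..<M}) \<in> (borel :: (nat \<Rightarrow> 'a::second_countable_topology) measure) \<rightarrow>\<^sub>M PiM {..<M} (\<lambda>_. borel)"
proof -
  have "(\<lambda>x. restrict x {..<M}) \<in> PiM UNIV (\<lambda>_. borel :: 'a measure) \<rightarrow>\<^sub>M PiM {..<M} (\<lambda>_. borel)"
    by (rule measurable_restrict_subset) simp
  then show ?thesis using measurable_cong_sets[OF sets_PiM_equal_borel refl] by blast
qed

section \<open>The upper bound: dual values on the finite power\<close>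

text \<open>Restricting both components to the first M coordinates pulls a coupling on sequence
  space back to the finite product. The marginals return because restriction fixes extensional
  functions, and the cost is unchanged because \<open>costM\<close> reads only these
  coordinates.\<close>

lemma W_PiM_le_W_borel:
  fixes c :: "'a::second_countable_topology \<Rightarrow> 'a \<Rightarrow> real"
  assumes lsc: "lsc_cost c"
    and R: "sets R = sets (PiM {..<M} (\<lambda>_. borel :: 'a measure))"
    and S: "sets S = sets (PiM {..<M} (\<lambda>_. borel :: 'a measure))"
  shows "W (costM c M) R S \<le> W (costM c M) (distr R borel (\<lambda>x. x)) (distr S borel (\<lambda>x. x))"
  unfolding W_def
proof (rule INF_greatest)
  fix L assume "L \<in> couplings (distr R borel (\<lambda>x. x)) (distr S borel (\<lambda>x. x))"
  then have L: "sets L = sets ((borel :: (nat \<Rightarrow> 'a) measure) \<Otimes>\<^sub>M (borel :: (nat \<Rightarrow> 'a) measure))"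
    "distr L (distr R borel (\<lambda>x. x)) fst = distr R borel (\<lambda>x. x)"
    "distr L (distr S borel (\<lambda>x. x)) snd = distr S borel (\<lambda>x. x)"
    by (auto simp: couplings_def cong: sets_pair_measure_cong)
  let ?r = "\<lambda>x :: nat \<Rightarrow> 'a. restrict x {..<M}"
  let ?rr = "\<lambda>z. (?r (fst z), ?r (snd z))"
  note [measurable_cong] = L(1) R S
  note [measurable] = measurable_id_PiM_borel[of M] measurable_restrict_borel_PiM[of M]
  define L' where "L' = distr L (R \<Otimes>\<^sub>M S) ?rr"
  have rr: "?rr \<in> L \<rightarrow>\<^sub>M R \<Otimes>\<^sub>M S" by measurable
  have round_trip: "distr (distr T borel (\<lambda>x. x)) T ?r = T" if T: "sets T = sets (PiM {..<M} (\<lambda>_. borel :: 'a measure))" for T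
  proof -
    note [measurable_cong] = T
    have "distr (distr T borel (\<lambda>x. x)) T ?r = distr T T (\<lambda>x. ?r x)"
      by (subst distr_distr) (auto simp: comp_def)
    also have "\<dots> = distr T T (\<lambda>x. x)"
      using sets_eq_imp_space_eq[OF T] by (intro distr_cong) (auto simp: space_PiM PiE_def extensional_restrict)
    finally show ?thesis by simp
  qed
  have "distr L' R fst = R"
  proof -
    have "distr L' R fst = distr L R (\<lambda>z. ?r (fst z))"
      unfolding L'_def by (subst distr_distr[OF _ rr]) (auto simp: comp_def)
    also have "\<dots> = distr (distr L (distr R borel (\<lambda>x. x)) fst) R ?r"
      by (subst distr_distr) (auto simp: comp_def)
    finally show ?thesis unfolding L(2) round_trip[OF R] .
  qed
  moreover have "distr L' S snd = S"
  proof -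
    have "distr L' S snd = distr L S (\<lambda>z. ?r (snd z))"
      unfolding L'_def by (subst distr_distr[OF _ rr]) (auto simp: comp_def)
    also have "\<dots> = distr (distr L (distr S borel (\<lambda>x. x)) snd) S ?r"
      by (subst distr_distr) (auto simp: comp_def)
    finally show ?thesis unfolding L(3) round_trip[OF S] .
  qed
  ultimately have "L' \<in> couplings R S" by (simp add: couplings_def L'_def)
  moreover have "(\<integral>\<^sup>+z. ennreal (costM c M (fst z) (snd z)) \<partial>L') = (\<integral>\<^sup>+z. ennreal (costM c M (fst z) (snd z)) \<partial>L)"
  proof -
    have [measurable]: "(\<lambda>z. c (fst z i) (snd z i)) \<in> borel_measurable (R \<Otimes>\<^sub>M S)" if "i < M" for i
    proof -
      have "(\<lambda>x. x i) \<in> PiM {..<M} (\<lambda>_. borel) \<rightarrow>\<^sub>M (borel :: 'a measure)"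
        using that by (intro measurable_component_singleton) simp
      then have [measurable]: "(\<lambda>x. x i) \<in> R \<rightarrow>\<^sub>M (borel :: 'a measure)" "(\<lambda>x. x i) \<in> S \<rightarrow>\<^sub>M (borel :: 'a measure)"
        using measurable_cong_sets[OF R refl] measurable_cong_sets[OF S refl] by blast+
      have "(\<lambda>z. (fst z i, snd z i)) \<in> R \<Otimes>\<^sub>M S \<rightarrow>\<^sub>M borel \<Otimes>\<^sub>M borel" by measurable
      from measurable_compose[OF this borel_measurable_lsc_cost[OF lsc]] show ?thesis by simp
    qed
    have "(\<lambda>z. ennreal (costM c M (fst z) (snd z))) \<in> borel_measurable (R \<Otimes>\<^sub>M S)"
      unfolding costM_def by measurable
    then show ?thesis
      unfolding L'_def by (subst nn_integral_distr[OF rr]) (auto simp: costM_def)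
  qed
  ultimately show "(INF L\<in>couplings R S. \<integral>\<^sup>+z. ennreal (costM c M (fst z) (snd z)) \<partial>L)
      \<le> (\<integral>\<^sup>+z. ennreal (costM c M (fst z) (snd z)) \<partial>L)"
    by (intro INF_lower2[of L']) auto
qed

lemma dual_le_product_cost:
  fixes c :: "'a::second_countable_topology \<Rightarrow> 'a \<Rightarrow> real" and f g :: "(nat \<Rightarrow> 'a) \<Rightarrow> real"
  assumes lsc: "lsc_cost c" and nn: "\<And>x y. 0 \<le> c x y"
    and P: "P \<in> prob_measures" and Q: "Q \<in> prob_measures"
    and fm: "f \<in> borel_measurable (PiM {..<M} (\<lambda>_. borel))" and gm: "g \<in> borel_measurable (PiM {..<M} (\<lambda>_. borel))"
    and fb: "\<And>x. \<bar>f x\<bar> \<le> B" and gb: "\<And>x. \<bar>g x\<bar> \<le> B"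
    and fg: "\<And>x y. f x + g y \<le> costM c M x y" and M: "0 < M"
  shows "ennreal (1 / M) * ennreal ((\<integral>x. f x \<partial>powM P M) + (\<integral>y. g y \<partial>powM Q M)) \<le> W c P Q"
  unfolding W_def
proof (rule INF_greatest)
  fix L assume L: "L \<in> couplings P Q"
  note P' = prob_measuresD[OF P] and Q' = prob_measuresD[OF Q]
  have Lp: "prob_space L" using couplings_prob_space[OF P'(1) L] .
  have sL: "sets L = sets (borel \<Otimes>\<^sub>M borel)"
    using L sets_pair_measure_cong[OF P'(2) Q'(2)] by (simp add: couplings_def)
  note [measurable_cong] = sL P'(2) Q'(2)
  let ?L = "PiM {..<M} (\<lambda>_. L)"
  interpret LM: prob_space ?L by (rule prob_space_PiM) (rule Lp)
  have mf: "f \<in> borel_measurable (powM P M)" and mg: "g \<in> borel_measurable (powM Q M)"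
    using fm gm measurable_cong_sets[OF sets_powM[OF P'(2), of M] refl] measurable_cong_sets[OF sets_powM[OF Q'(2), of M] refl] by blast+
  \<comment> \<open>The M-fold product of L lives on tuples of pairs; reading off all first or all
    second components recovers the two powers.\<close>
  have pP: "powM P M = distr ?L (powM P M) (compose {..<M} fst)"
  proof -
    have "distr ?L (PiM {..<M} (\<lambda>_. P)) (compose {..<M} fst) = PiM {..<M} (\<lambda>_. distr L P fst)"
      using Lp P'(1) by (intro distr_PiM_finite_prob_space') auto
    then show ?thesis using L by (simp add: powM_def couplings_def)
  qed
  have pQ: "powM Q M = distr ?L (powM Q M) (compose {..<M} snd)"
  proof -
    have "distr ?L (PiM {..<M} (\<lambda>_. Q)) (compose {..<M} snd) = PiM {..<M} (\<lambda>_. distr L Q snd)"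
      using Lp Q'(1) by (intro distr_PiM_finite_prob_space') auto
    then show ?thesis using L by (simp add: powM_def couplings_def)
  qed
  have cm: "compose {..<M} fst \<in> ?L \<rightarrow>\<^sub>M powM P M" "compose {..<M} snd \<in> ?L \<rightarrow>\<^sub>M powM Q M"
    unfolding powM_def compose_def by (auto intro!: measurable_restrict)
  have f1: "(\<integral>x. f x \<partial>powM P M) = (\<integral>z. f (compose {..<M} fst z) \<partial>?L)"
    by (subst pP) (rule integral_distr[OF cm(1) mf])
  have g1: "(\<integral>x. g x \<partial>powM Q M) = (\<integral>z. g (compose {..<M} snd z) \<partial>?L)"
    by (subst pQ) (rule integral_distr[OF cm(2) mg])
  have fi: "integrable ?L (\<lambda>z. f (compose {..<M} fst z))" "integrable ?L (\<lambda>z. g (compose {..<M} snd z))"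
    using fb gb measurable_compose[OF cm(1) mf] measurable_compose[OF cm(2) mg]
    by (auto intro!: LM.integrable_const_bound[where B=B])
  have cL: "(\<lambda>z. c (fst z) (snd z)) \<in> borel_measurable L"
    using borel_measurable_lsc_cost[OF lsc] measurable_cong_sets[OF sL refl] by blast
  have ci: "(\<lambda>z. z i) \<in> ?L \<rightarrow>\<^sub>M L" if "i < M" for i
    using that by (intro measurable_component_singleton) simp
  have "ennreal ((\<integral>x. f x \<partial>powM P M) + (\<integral>y. g y \<partial>powM Q M))
     = ennreal (\<integral>z. f (compose {..<M} fst z) + g (compose {..<M} snd z) \<partial>?L)"
    unfolding f1 g1 using fi by simp
  also have "\<dots> \<le> (\<integral>\<^sup>+z. ennreal (f (compose {..<M} fst z) + g (compose {..<M} snd z)) \<partial>?L)"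
    using fi by (intro ennreal_integral_le_nn_integral) auto
  also have "\<dots> \<le> (\<integral>\<^sup>+z. (\<Sum>i<M. ennreal (c (fst (z i)) (snd (z i)))) \<partial>?L)"
  proof (intro nn_integral_mono)
    fix z
    have "f (compose {..<M} fst z) + g (compose {..<M} snd z) \<le> (\<Sum>i<M. c (fst (z i)) (snd (z i)))"
      using fg[of "compose {..<M} fst z" "compose {..<M} snd z"] by (simp add: costM_def compose_def)
    then show "ennreal (f (compose {..<M} fst z) + g (compose {..<M} snd z)) \<le> (\<Sum>i<M. ennreal (c (fst (z i)) (snd (z i))))"
      using nn by (subst sum_ennreal) (auto intro: ennreal_leI)
  qed
  also have "\<dots> = (\<Sum>i<M. \<integral>\<^sup>+z. ennreal (c (fst (z i)) (snd (z i))) \<partial>?L)"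
    using measurable_compose[OF ci cL] by (intro nn_integral_sum) auto
  also have "\<dots> = (\<Sum>i<M. \<integral>\<^sup>+z. ennreal (c (fst z) (snd z)) \<partial>L)"
  proof (intro sum.cong refl)
    fix i assume i: "i \<in> {..<M}"
    have "(\<integral>\<^sup>+z. ennreal (c (fst z) (snd z)) \<partial>L) = (\<integral>\<^sup>+z. ennreal (c (fst z) (snd z)) \<partial>distr ?L L (\<lambda>z. z i))"
      using i Lp by (subst distr_PiM_component) auto
    also have "\<dots> = (\<integral>\<^sup>+z. ennreal (c (fst (z i)) (snd (z i))) \<partial>?L)"
      using i ci cL by (intro nn_integral_distr) auto
    finally show "(\<integral>\<^sup>+z. ennreal (c (fst (z i)) (snd (z i))) \<partial>?L) = (\<integral>\<^sup>+z. ennreal (c (fst z) (snd z)) \<partial>L)" ..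
  qed
  also have "\<dots> = ennreal M * (\<integral>\<^sup>+z. ennreal (c (fst z) (snd z)) \<partial>L)"
    by (simp add: ennreal_of_nat_eq_real_of_nat)
  finally have "ennreal (1 / M) * ennreal ((\<integral>x. f x \<partial>powM P M) + (\<integral>y. g y \<partial>powM Q M))
      \<le> ennreal (1 / M) * (ennreal M * (\<integral>\<^sup>+z. ennreal (c (fst z) (snd z)) \<partial>L))"
    by (rule mult_left_mono) simp
  also have "\<dots> = (\<integral>\<^sup>+z. ennreal (c (fst z) (snd z)) \<partial>L)"
    using M by (simp add: mult.assoc[symmetric] ennreal_mult'[symmetric])
  finally show "ennreal (1 / M) * ennreal ((\<integral>x. f x \<partial>powM P M) + (\<integral>y. g y \<partial>powM Q M))
      \<le> (\<integral>\<^sup>+z. ennreal (c (fst z) (snd z)) \<partial>L)" .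
qed

lemma W_mixture_le:
  fixes c :: "'a::polish_space \<Rightarrow> 'a \<Rightarrow> real" and \<nu> :: "'a measure measure"
  assumes lsc: "lsc_cost c" and nn: "\<And>x y. 0 \<le> c x y"
    and \<nu>: "prob_space \<nu>" "sets \<nu> = sets (prob_algebra borel)"
    and Q: "Q \<in> prob_measures" and M: "0 < M"
  shows "ennreal (1 / M) * W (costM c M) (mixture \<nu> M) (powM Q M) \<le> (\<integral>\<^sup>+P. W c P Q \<partial>\<nu>)"
proof -
  interpret \<nu>: prob_space \<nu> by fact
  note Q' = prob_measuresD[OF Q]
  let ?S = "PiM {..<M} (\<lambda>_. borel :: 'a measure)"
  obtain f g :: "nat \<Rightarrow> (nat \<Rightarrow> 'a) \<Rightarrow> real" and B :: "nat \<Rightarrow> real" where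
    fm: "\<And>k. f k \<in> borel_measurable borel" and gm: "\<And>k. g k \<in> borel_measurable borel"
    and fb: "\<And>k x. \<bar>f k x\<bar> \<le> B k" and gb: "\<And>k x. \<bar>g k x\<bar> \<le> B k"
    and fg: "\<And>k x y. f k x + g k y \<le> costM c M x y"
    and dual: "\<And>P Q. P \<in> prob_measures \<Longrightarrow> Q \<in> prob_measures \<Longrightarrow>
       W (costM c M) P Q \<le> (SUP k. ennreal ((\<integral>x. f k x \<partial>P) + (\<integral>y. g k y \<partial>Q)))"
    by (rule kantorovich_duality_countable[OF lsc_cost_costM[OF lsc], of M])
       (auto simp: costM_def intro!: sum_nonneg nn)
  have fm': "f k \<in> borel_measurable ?S" and gm': "g k \<in> borel_measurable ?S" for k
    using measurable_compose[OF measurable_id_PiM_borel fm] measurable_compose[OF measurable_id_PiM_borel gm] by auto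
  note mp = mixture_properties[OF \<nu>, of M]
  interpret QM: prob_space "powM Q M" by (rule prob_space_powM) (rule Q')
  have sQ: "sets (powM Q M) = sets ?S" by (rule sets_powM) (rule Q')
  have id1: "(\<lambda>x. x) \<in> mixture \<nu> M \<rightarrow>\<^sub>M borel" "(\<lambda>x. x) \<in> powM Q M \<rightarrow>\<^sub>M borel"
    using measurable_id_PiM_borel[of M, where 'a='a] measurable_cong_sets[OF mp(2) refl] measurable_cong_sets[OF sQ refl] by blast+
  let ?R = "distr (mixture \<nu> M) borel (\<lambda>x. x)" and ?T = "distr (powM Q M) borel (\<lambda>x. x)"
  have pm: "?R \<in> prob_measures" "?T \<in> prob_measures"
    using prob_space.prob_space_distr[OF mp(1) id1(1)] QM.prob_space_distr[OF id1(2)]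
    by (auto simp: prob_measures_def)
  have "W (costM c M) (mixture \<nu> M) (powM Q M) \<le> W (costM c M) ?R ?T"
    by (rule W_PiM_le_W_borel[OF lsc mp(2) sQ])
  also have "\<dots> \<le> (SUP k. ennreal ((\<integral>x. f k x \<partial>?R) + (\<integral>y. g k y \<partial>?T)))"
    by (rule dual[OF pm])
  finally have 1: "W (costM c M) (mixture \<nu> M) (powM Q M) \<le> (SUP k. ennreal ((\<integral>x. f k x \<partial>?R) + (\<integral>y. g k y \<partial>?T)))" .
  have 2: "ennreal (1 / M) * ennreal ((\<integral>x. f k x \<partial>?R) + (\<integral>y. g k y \<partial>?T)) \<le> (\<integral>\<^sup>+P. W c P Q \<partial>\<nu>)" for k
  proof -
    \<comment> \<open>The second integral does not depend on P, so the dual value at the mixture is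
      the \<nu>-average of \<open>?v\<close>. The supremum over k is taken only after each average
      has been bounded.\<close>
    let ?v = "\<lambda>P. (\<integral>x. f k x \<partial>powM P M) + (\<integral>y. g k y \<partial>powM Q M)"
    have "(\<integral>x. f k x \<partial>?R) = (\<integral>x. f k x \<partial>mixture \<nu> M)" by (rule integral_distr[OF id1(1) fm])
    also have "\<dots> = (\<integral>P. (\<integral>x. f k x \<partial>powM P M) \<partial>\<nu>)" by (rule integral_mixture(1)[OF \<nu> fm' fb])
    finally have a: "(\<integral>x. f k x \<partial>?R) = \<dots>" .
    have b: "(\<integral>x. g k x \<partial>?T) = (\<integral>x. g k x \<partial>powM Q M)" by (rule integral_distr[OF id1(2) gm])
    note i = integral_mixture(2)[OF \<nu> fm' fb, of k]
    have iv: "integrable \<nu> ?v" using i by simp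
    have "ennreal ((\<integral>x. f k x \<partial>?R) + (\<integral>y. g k y \<partial>?T)) = ennreal (\<integral>P. ?v P \<partial>\<nu>)"
      unfolding a b using i by (simp add: \<nu>.prob_space)
    also have "\<dots> \<le> (\<integral>\<^sup>+P. ennreal (?v P) \<partial>\<nu>)" by (rule ennreal_integral_le_nn_integral[OF iv])
    finally have "ennreal (1 / M) * ennreal ((\<integral>x. f k x \<partial>?R) + (\<integral>y. g k y \<partial>?T)) \<le> ennreal (1 / M) * (\<integral>\<^sup>+P. ennreal (?v P) \<partial>\<nu>)"
      by (rule mult_left_mono) simp
    also have "\<dots> = (\<integral>\<^sup>+P. ennreal (1 / M) * ennreal (?v P) \<partial>\<nu>)"
      using iv by (intro nn_integral_cmult[symmetric]) auto
    also have "\<dots> \<le> (\<integral>\<^sup>+P. W c P Q \<partial>\<nu>)"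
    proof (rule nn_integral_mono)
      fix P assume "P \<in> space \<nu>"
      then have "P \<in> prob_measures"
        unfolding prob_measures_eq_space_prob_algebra using sets_eq_imp_space_eq[OF \<nu>(2)] by simp
      then show "ennreal (1 / M) * ennreal (?v P) \<le> W c P Q"
        by (rule dual_le_product_cost[OF lsc nn _ Q fm' gm' fb gb fg M])
    qed
    finally show ?thesis .
  qed
  have "ennreal (1 / M) * W (costM c M) (mixture \<nu> M) (powM Q M)
      \<le> ennreal (1 / M) * (SUP k. ennreal ((\<integral>x. f k x \<partial>?R) + (\<integral>y. g k y \<partial>?T)))"
    using 1 by (rule mult_left_mono) simp
  also have "\<dots> = (SUP k. ennreal (1 / M) * ennreal ((\<integral>x. f k x \<partial>?R) + (\<integral>y. g k y \<partial>?T)))"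
    by (rule SUP_mult_left_ennreal)
  also have "\<dots> \<le> (\<integral>\<^sup>+P. W c P Q \<partial>\<nu>)" using 2 by (rule SUP_least)
  finally show ?thesis .
qed

section \<open>The lower bound for finitely many dual pairs\<close>

text \<open>\<open>F\<close> depends on x only and \<open>H\<close> on y only, so their integrals
  under a coupling are determined by the marginals. The pointwise bound of \<open>F x\<close> by the
  averaged cost plus \<open>H y\<close> thus gives an estimate that is uniform over couplings and
  survives the infimum.\<close>

lemma nn_integral_finite_dual_le:
  fixes c :: "'a::polish_space \<Rightarrow> 'a \<Rightarrow> real" and \<nu> :: "'a measure measure" and f g :: "nat \<Rightarrow> 'a \<Rightarrow> real"
  assumes lsc: "lsc_cost c" and nn: "\<And>x y. 0 \<le> c x y"
    and \<nu>: "prob_space \<nu>" "sets \<nu> = sets (prob_algebra borel)"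
    and Q: "Q \<in> prob_measures" and M: "0 < M"
    and fm: "\<And>k. f k \<in> borel_measurable borel" and gm: "\<And>k. g k \<in> borel_measurable borel"
    and fb: "\<And>k x. \<bar>f k x\<bar> \<le> B k" and gb: "\<And>k x. \<bar>g k x\<bar> \<le> B k"
    and fg: "\<And>k x y. f k x + g k y \<le> c x y"
  shows "(\<integral>\<^sup>+P. (SUP k\<in>{..N}. ennreal ((\<integral>x. f k x \<partial>P) + (\<integral>y. g k y \<partial>Q))) \<partial>\<nu>)
    \<le> ennreal (1 / M) * W (costM c M) (mixture \<nu> M) (powM Q M)
       + ennreal ((\<Sum>k\<le>N. 1 + (2 * B k)\<^sup>2) / sqrt M)"
    (is "?T \<le> _ + ?e")
proof -
  let ?S = "PiM {..<M} (\<lambda>_. borel :: 'a measure)"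
  note Q' = prob_measuresD[OF Q]
  note mp = mixture_properties[OF \<nu>, of M]
  have sQ: "sets (powM Q M) = sets ?S" by (rule sets_powM) (rule Q')
  define \<beta> where "\<beta> k = (\<integral>y. g k y \<partial>Q)" for k
  define a where "a k x = (\<Sum>i<M. f k (x i)) / M" for k and x :: "nat \<Rightarrow> 'a"
  define b where "b k y = (\<Sum>i<M. g k (y i)) / M" for k and y :: "nat \<Rightarrow> 'a"
  have comp: "(\<lambda>x. x i) \<in> ?S \<rightarrow>\<^sub>M borel" if "i < M" for i
    using that by (intro measurable_component_singleton) simp
  have am: "a k \<in> borel_measurable ?S" and bm: "b k \<in> borel_measurable ?S" for k
    unfolding a_def b_def
    by (intro borel_measurable_divide borel_measurable_sum borel_measurable_const
        measurable_compose[OF comp fm] measurable_compose[OF comp gm]; simp)+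
  define F where "F x = (SUP k\<in>{..N}. ennreal (a k x + \<beta> k))" for x
  \<comment> \<open>A sum in place of a maximum of deviations: it still dominates each one, and its
    integral splits into one law-of-large-numbers estimate per k.\<close>
  define H where "H y = (\<Sum>k\<le>N. ennreal \<bar>b k y - \<beta> k\<bar>)" for y
  have Fm: "F \<in> borel_measurable ?S" unfolding F_def
    by (intro borel_measurable_SUP measurable_compose[OF _ measurable_ennreal] borel_measurable_add am) auto
  have Hm: "H \<in> borel_measurable ?S" unfolding H_def
    by (intro borel_measurable_sum measurable_compose[OF _ measurable_ennreal] borel_measurable_abs borel_measurable_diff bm) auto
  have "?T \<le> (\<integral>\<^sup>+P. (\<integral>\<^sup>+x. F x \<partial>powM P M) \<partial>\<nu>)"
  proof (intro nn_integral_mono SUP_least)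
    fix P k assume "P \<in> space \<nu>" and k: "k \<in> {..N}"
    then have "P \<in> prob_measures"
      unfolding prob_measures_eq_space_prob_algebra using sets_eq_imp_space_eq[OF \<nu>(2)] by simp
    note P' = prob_measuresD[OF this]
    interpret P: prob_space P by (rule P')
    interpret PM: prob_space "powM P M" by (rule prob_space_powM) (rule P')
    note [measurable_cong] = P'(2)
    have fP: "integrable (powM P M) (\<lambda>x. f k (x i))" and fPe: "(\<integral>x. f k (x i) \<partial>powM P M) = (\<integral>x. f k x \<partial>P)" if "i < M" for i
    proof -
      have c: "(\<lambda>x. x i) \<in> powM P M \<rightarrow>\<^sub>M P"
        unfolding powM_def using that by (intro measurable_component_singleton) simp
      have fkP: "f k \<in> borel_measurable P" using fm[of k] measurable_cong_sets[OF P'(2) refl] by blast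
      show "integrable (powM P M) (\<lambda>x. f k (x i))"
        using fb measurable_compose[OF c fkP] by (intro PM.integrable_const_bound[where B="B k"]) auto
      have "(\<integral>x. f k x \<partial>P) = (\<integral>x. f k x \<partial>distr (powM P M) P (\<lambda>x. x i))"
        unfolding powM_def using that P'(1) by (subst distr_PiM_component) auto
      also have "\<dots> = (\<integral>x. f k (x i) \<partial>powM P M)" by (rule integral_distr[OF c fkP])
      finally show "(\<integral>x. f k (x i) \<partial>powM P M) = (\<integral>x. f k x \<partial>P)" ..
    qed
    have ai: "integrable (powM P M) (a k)"
      unfolding a_def by (intro integrable_divide_zero Bochner_Integration.integrable_sum fP) auto
    have "(\<integral>x. a k x + \<beta> k \<partial>powM P M) = (\<integral>x. f k x \<partial>P) + \<beta> k"
    proof -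
      have "(\<integral>x. a k x \<partial>powM P M) = (\<Sum>i<M. \<integral>x. f k (x i) \<partial>powM P M) / M"
        unfolding a_def integral_divide_zero by (subst Bochner_Integration.integral_sum) (auto intro: fP)
      also have "\<dots> = (\<integral>x. f k x \<partial>P)" using M fPe by simp
      finally show ?thesis using ai by (simp add: PM.prob_space)
    qed
    then have "ennreal ((\<integral>x. f k x \<partial>P) + (\<integral>y. g k y \<partial>Q)) = ennreal (\<integral>x. a k x + \<beta> k \<partial>powM P M)"
      by (simp add: \<beta>_def)
    also have "\<dots> \<le> (\<integral>\<^sup>+x. ennreal (a k x + \<beta> k) \<partial>powM P M)"
      using ai by (intro ennreal_integral_le_nn_integral) auto
    also have "\<dots> \<le> (\<integral>\<^sup>+x. F x \<partial>powM P M)"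
      unfolding F_def using k by (intro nn_integral_mono SUP_upper)
    finally show "ennreal ((\<integral>x. f k x \<partial>P) + (\<integral>y. g k y \<partial>Q)) \<le> (\<integral>\<^sup>+x. F x \<partial>powM P M)" .
  qed
  also have "\<dots> = (\<integral>\<^sup>+x. F x \<partial>mixture \<nu> M)"
    by (rule nn_integral_mixture[OF \<nu> Fm, symmetric])
  finally have T1: "?T \<le> (\<integral>\<^sup>+x. F x \<partial>mixture \<nu> M)" .
  have H1: "(\<integral>\<^sup>+y. H y \<partial>powM Q M) \<le> ?e"
  proof -
    have bm': "b k \<in> borel_measurable (powM Q M)" for k
      using bm[of k] measurable_cong_sets[OF sQ refl] by blast
    have "(\<integral>\<^sup>+y. H y \<partial>powM Q M) = (\<Sum>k\<le>N. \<integral>\<^sup>+y. ennreal \<bar>b k y - \<beta> k\<bar> \<partial>powM Q M)"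
      unfolding H_def using bm' by (intro nn_integral_sum) auto
    also have "\<dots> \<le> (\<Sum>k\<le>N. ennreal ((1 + (2 * B k)\<^sup>2) / sqrt M))"
      unfolding b_def \<beta>_def
    proof (intro sum_mono nn_integral_average_deviation[OF Q'(1) _ gb M])
      show "g k \<in> borel_measurable Q" for k
        using gm[of k] measurable_cong_sets[OF Q'(2) refl] by blast
    qed
    also have "\<dots> = ennreal (\<Sum>k\<le>N. (1 + (2 * B k)\<^sup>2) / sqrt M)"
      by (intro sum_ennreal) (auto intro!: divide_nonneg_nonneg)
    also have "\<dots> = ?e" by (simp add: sum_divide_distrib)
    finally show ?thesis .
  qed
  \<comment> \<open>The finite error is moved to the left, so that the right side is a multiple of
    the transport cost alone and the infimum over couplings can be taken.\<close>
  have "?T - ?e \<le> ennreal (1 / M) * (\<integral>\<^sup>+z. ennreal (costM c M (fst z) (snd z)) \<partial>L)"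
    if L: "L \<in> couplings (mixture \<nu> M) (powM Q M)" for L
  proof -
    have sL: "sets L = sets (mixture \<nu> M \<Otimes>\<^sub>M powM Q M)" using L by (simp add: couplings_def)
    have f1: "fst \<in> L \<rightarrow>\<^sub>M mixture \<nu> M" and s1: "snd \<in> L \<rightarrow>\<^sub>M powM Q M"
      using measurable_cong_sets[OF sL refl] measurable_fst measurable_snd by blast+
    have Fm': "F \<in> borel_measurable (mixture \<nu> M)" and Hm': "H \<in> borel_measurable (powM Q M)"
      using Fm Hm measurable_cong_sets[OF mp(2) refl] measurable_cong_sets[OF sQ refl] by blast+
    have cm: "(\<lambda>z. ennreal (costM c M (fst z) (snd z))) \<in> borel_measurable L"
    proof -
      have "(\<lambda>z. c (fst z i) (snd z i)) \<in> borel_measurable L" if "i < M" for i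
      proof -
        have "(\<lambda>x. x i) \<in> mixture \<nu> M \<rightarrow>\<^sub>M borel" "(\<lambda>x. x i) \<in> powM Q M \<rightarrow>\<^sub>M borel"
          using comp[OF that] measurable_cong_sets[OF mp(2) refl] measurable_cong_sets[OF sQ refl] by blast+
        then have "(\<lambda>z. (fst z i, snd z i)) \<in> L \<rightarrow>\<^sub>M borel \<Otimes>\<^sub>M borel"
          using f1 s1 by (intro measurable_Pair) (auto intro: measurable_compose)
        from measurable_compose[OF this borel_measurable_lsc_cost[OF lsc]] show ?thesis by simp
      qed
      then show ?thesis unfolding costM_def by (intro measurable_compose[OF _ measurable_ennreal] borel_measurable_sum) simp
    qed
    have pt: "F x \<le> ennreal (1 / M) * ennreal (costM c M x y) + H y" for x y
      unfolding F_def
    proof (rule SUP_least)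
      fix k assume k: "k \<in> {..N}"
      have "a k x + b k y \<le> 1 / M * costM c M x y"
      proof -
        have "(\<Sum>i<M. f k (x i)) + (\<Sum>i<M. g k (y i)) \<le> costM c M x y"
          unfolding costM_def sum.distrib[symmetric] by (intro sum_mono fg)
        then show ?thesis using M unfolding a_def b_def add_divide_distrib[symmetric]
          by (simp add: divide_right_mono)
      qed
      then have "a k x + \<beta> k \<le> 1 / M * costM c M x y + \<bar>b k y - \<beta> k\<bar>" by linarith
      then have "ennreal (a k x + \<beta> k) \<le> ennreal (1 / M * costM c M x y + \<bar>b k y - \<beta> k\<bar>)"
        by (rule ennreal_leI)
      also have "\<dots> = ennreal (1 / M * costM c M x y) + ennreal \<bar>b k y - \<beta> k\<bar>"
        using nn by (intro ennreal_plus) (auto simp: costM_def intro!: sum_nonneg divide_nonneg_nonneg)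
      also have "ennreal (1 / M * costM c M x y) = ennreal (1 / M) * ennreal (costM c M x y)"
        by (rule ennreal_mult') simp
      also have "ennreal \<bar>b k y - \<beta> k\<bar> \<le> H y"
        unfolding H_def using k by (intro member_le_sum) auto
      finally show "ennreal (a k x + \<beta> k) \<le> ennreal (1 / M) * ennreal (costM c M x y) + H y"
        by (simp add: add_left_mono)
    qed
    have "(\<integral>\<^sup>+x. F x \<partial>mixture \<nu> M) = (\<integral>\<^sup>+x. F x \<partial>distr L (mixture \<nu> M) fst)" using L by (simp add: couplings_def)
    also have "\<dots> = (\<integral>\<^sup>+z. F (fst z) \<partial>L)" by (rule nn_integral_distr[OF f1]) (simp add: Fm')
    also have "\<dots> \<le> (\<integral>\<^sup>+z. ennreal (1 / M) * ennreal (costM c M (fst z) (snd z)) + H (snd z) \<partial>L)"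
      by (intro nn_integral_mono pt)
    also have "\<dots> = ennreal (1 / M) * (\<integral>\<^sup>+z. ennreal (costM c M (fst z) (snd z)) \<partial>L) + (\<integral>\<^sup>+z. H (snd z) \<partial>L)"
      using cm measurable_compose[OF s1 Hm'] by (simp add: nn_integral_add nn_integral_cmult)
    also have "(\<integral>\<^sup>+z. H (snd z) \<partial>L) = (\<integral>\<^sup>+y. H y \<partial>distr L (powM Q M) snd)"
      by (rule nn_integral_distr[OF s1, symmetric]) (simp add: Hm')
    also have "\<dots> = (\<integral>\<^sup>+y. H y \<partial>powM Q M)" using L by (simp add: couplings_def)
    finally have "?T \<le> ennreal (1 / M) * (\<integral>\<^sup>+z. ennreal (costM c M (fst z) (snd z)) \<partial>L) + ?e"
      using T1 H1 by (meson add_left_mono order_trans)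
    then show ?thesis by (simp add: ennreal_minus_le_iff add.commute)
  qed
  then have "ennreal M * (?T - ?e) \<le> W (costM c M) (mixture \<nu> M) (powM Q M)"
    unfolding W_def
  proof (intro INF_greatest)
    fix L assume "L \<in> couplings (mixture \<nu> M) (powM Q M)"
      and "\<And>L. L \<in> couplings (mixture \<nu> M) (powM Q M) \<Longrightarrow>
         ?T - ?e \<le> ennreal (1 / M) * (\<integral>\<^sup>+z. ennreal (costM c M (fst z) (snd z)) \<partial>L)"
    then have "ennreal M * (?T - ?e) \<le> ennreal M * (ennreal (1 / M) * (\<integral>\<^sup>+z. ennreal (costM c M (fst z) (snd z)) \<partial>L))"
      by (intro mult_left_mono) auto
    also have "\<dots> = (\<integral>\<^sup>+z. ennreal (costM c M (fst z) (snd z)) \<partial>L)"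
      using M by (simp add: mult.assoc[symmetric] ennreal_mult'[symmetric])
    finally show "ennreal M * (?T - ?e) \<le> (\<integral>\<^sup>+z. ennreal (costM c M (fst z) (snd z)) \<partial>L)" .
  qed
  then have "ennreal (1 / M) * (ennreal M * (?T - ?e)) \<le> ennreal (1 / M) * W (costM c M) (mixture \<nu> M) (powM Q M)"
    by (rule mult_left_mono) simp
  moreover have "ennreal (1 / M) * (ennreal M * (?T - ?e)) = ?T - ?e"
    using M by (simp add: mult.assoc[symmetric] ennreal_mult'[symmetric])
  ultimately show ?thesis by (simp add: ennreal_minus_le_iff add.commute)
qed

theorem mainTheorem13:
  fixes c :: "'a::polish_space \<Rightarrow> 'a \<Rightarrow> real"
    and \<nu> :: "'a measure measure"
    and Phat :: "'a measure"
  assumes "proper_cost c"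
    and "\<forall>x y. c x y \<ge> 0"
    and "prob_space \<nu>"
    and "sets \<nu> = sets (prob_algebra (borel :: 'a measure))"
    and "Phat \<in> Pc c"
  shows "(SUP M\<in>{1::nat..}. ennreal (1 / real M) * W (costM c M) (mixture \<nu> M) (powM Phat M))
         = (\<integral>\<^sup>+P. W c P Phat \<partial>\<nu>)"
    (is "?lhs = ?rhs")
proof (rule antisym)
  have lsc: "lsc_cost c" using assms(1) by (simp add: proper_cost_def transport_cost_def)
  have nn: "\<And>x y. 0 \<le> c x y" using assms(2) by simp
  have Q: "Phat \<in> prob_measures" using assms(5) by (simp add: Pc_def)
  show "?lhs \<le> ?rhs"
    by (intro SUP_least W_mixture_le[OF lsc nn assms(3,4) Q]) auto
  obtain f g :: "nat \<Rightarrow> 'a \<Rightarrow> real" and B :: "nat \<Rightarrow> real" where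
    fm: "\<And>k. f k \<in> borel_measurable borel" and gm: "\<And>k. g k \<in> borel_measurable borel"
    and fb: "\<And>k x. \<bar>f k x\<bar> \<le> B k" and gb: "\<And>k x. \<bar>g k x\<bar> \<le> B k"
    and fg: "\<And>k x y. f k x + g k y \<le> c x y"
    and dual: "\<And>P Q. P \<in> prob_measures \<Longrightarrow> Q \<in> prob_measures \<Longrightarrow>
       W c P Q \<le> (SUP k. ennreal ((\<integral>x. f k x \<partial>P) + (\<integral>y. g k y \<partial>Q)))"
    by (rule kantorovich_duality_countable[OF lsc nn]) blast
  let ?v = "\<lambda>k P. ennreal ((\<integral>x. f k x \<partial>P) + (\<integral>y. g k y \<partial>Phat))"
  have vm: "?v k \<in> borel_measurable \<nu>" for k
  proof -
    have "(\<lambda>P. \<integral>x. f k x \<partial>P) \<in> borel_measurable (prob_algebra borel)"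
      unfolding prob_algebra_def
      by (intro measurable_restrict_space1 integral_measurable_subprob_algebra fm)
    then have "(\<lambda>P. \<integral>x. f k x \<partial>P) \<in> borel_measurable \<nu>"
      using measurable_cong_sets[OF assms(4) refl] by blast
    then show ?thesis by measurable
  qed
  \<comment> \<open>N is fixed before M grows: the error is a constant depending on N over the
    square root of M, and the bounds \<open>B k\<close> are not assumed uniform in k.\<close>
  have fin: "(\<integral>\<^sup>+P. (SUP k\<in>{..N}. ?v k P) \<partial>\<nu>) \<le> ?lhs" for N
  proof (rule LIMSEQ_le_const)
    let ?K = "\<Sum>k\<le>N. 1 + (2 * B k)\<^sup>2"
    have "(\<lambda>M. ?K / sqrt (real M)) \<longlonglongrightarrow> 0"
      by (intro real_tendsto_divide_at_top[OF tendsto_const] filterlim_compose[OF sqrt_at_top] filterlim_real_sequentially)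
    then have "(\<lambda>M. ?lhs + ennreal (?K / sqrt (real M))) \<longlonglongrightarrow> ?lhs + ennreal 0"
      by (intro tendsto_add tendsto_const tendsto_ennrealI)
    then show "(\<lambda>M. ?lhs + ennreal (?K / sqrt (real M))) \<longlonglongrightarrow> ?lhs" by simp
    have "(\<integral>\<^sup>+P. (SUP k\<in>{..N}. ?v k P) \<partial>\<nu>) \<le> ?lhs + ennreal (?K / sqrt (real M))" if "1 \<le> M" for M
    proof -
      have "(\<integral>\<^sup>+P. (SUP k\<in>{..N}. ?v k P) \<partial>\<nu>) \<le> ennreal (1 / M) * W (costM c M) (mixture \<nu> M) (powM Phat M) + ennreal (?K / sqrt (real M))"
        using that by (intro nn_integral_finite_dual_le[OF lsc nn assms(3,4) Q _ fm gm fb gb fg]) auto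
      also have "\<dots> \<le> ?lhs + ennreal (?K / sqrt (real M))"
        using that by (intro add_right_mono SUP_upper) auto
      finally show ?thesis .
    qed
    then show "\<exists>n. \<forall>M\<ge>n. (\<integral>\<^sup>+P. (SUP k\<in>{..N}. ?v k P) \<partial>\<nu>) \<le> ?lhs + ennreal (?K / sqrt (real M))" by blast
  qed
  \<comment> \<open>Passing to the finite maxima makes the integrands measurable and increasing in
    N, as monotone convergence requires.\<close>
  have "?rhs \<le> (\<integral>\<^sup>+P. (SUP N. SUP k\<in>{..N}. ?v k P) \<partial>\<nu>)"
  proof (rule nn_integral_mono)
    fix P assume "P \<in> space \<nu>"
    then have "P \<in> prob_measures"
      unfolding prob_measures_eq_space_prob_algebra using sets_eq_imp_space_eq[OF assms(4)] by simp
    from dual[OF this Q] have "W c P Phat \<le> (SUP k. ?v k P)" .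
    also have "\<dots> \<le> (SUP N. SUP k\<in>{..N}. ?v k P)"
      by (intro SUP_mono) (auto intro: SUP_upper)
    finally show "W c P Phat \<le> (SUP N. SUP k\<in>{..N}. ?v k P)" .
  qed
  also have "\<dots> = (SUP N. \<integral>\<^sup>+P. (SUP k\<in>{..N}. ?v k P) \<partial>\<nu>)"
  proof (rule nn_integral_monotone_convergence_SUP)
    show "incseq (\<lambda>N P. SUP k\<in>{..N}. ?v k P)"
      by (auto simp: incseq_def le_fun_def intro!: SUP_subset_mono)
    show "(\<lambda>P. SUP k\<in>{..N}. ?v k P) \<in> borel_measurable \<nu>" for N
      by (intro borel_measurable_SUP vm) simp
  qed
  also have "\<dots> \<le> ?lhs" using fin by (rule SUP_least)
  finally show "?rhs \<le> ?lhs" .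
qed

end
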